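(* Let $\Omega\subset\mathbb C^n$ be a bounded domain and $p\ge1$. For any $f\in A^p(\Omega)$ and any $z\in\Omega$ we have $$f(z)=m_p(z)^{-p}\int_\Omega|m_p(\cdot,z)|^{p-2}\,\overline{m_p(\cdot,z)}\,f=\int_\Omega|m_p(\cdot,z)|^{p-2}\,\overline{K_p(\cdot,z)}\,f.$$
   Context: For $p\ge1$, $A^p(\Omega)$ is the space of holomorphic functions $f$ on $\Omega$ with $\|f\|_p^p:=\int_\Omega|f|^p<\infty$ (all integrals are with respect to Lebesgue measure). Put $m_p(z):=\inf\{\|f\|_p: f\in A^p(\Omega),\ f(z)=1\}$. For $p\ge1$ the infimum is attained by exactly one function, denoted $m_p(\cdot,z)$. Set $K_p(z):=m_p(z)^{-p}$ and $K_p(\zeta,z):=m_p(\zeta,z)K_p(z)$. The integrands are defined off the zero set of $m_p(\cdot,z)$, which has Lebesgue measure zero. *)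

theory Defs
  imports "HOL-Analysis.Analysis"
begin

text \<open>
  Holomorphy in several variables, meant for an open set \<open>\<Omega>\<close>: the real Frechet derivative exists at
  every point and is complex linear (its additivity is part of \<open>has_derivative\<close>).
\<close>

definition holomorphic_several_on :: "(complex^'n \<Rightarrow> complex) \<Rightarrow> (complex^'n) set \<Rightarrow> bool"
  where "holomorphic_several_on f \<Omega> \<longleftrightarrow>
    (\<forall>z\<in>\<Omega>. \<exists>D. (f has_derivative D) (at z) \<and> (\<forall>c v. D (c *s v) = c * D v))"

definition bergman_space :: "real \<Rightarrow> (complex^'n) set \<Rightarrow> (complex^'n \<Rightarrow> complex) set"
  where "bergman_space p \<Omega> =
    {f. holomorphic_several_on f \<Omega> \<and> set_integrable lebesgue \<Omega> (\<lambda>w. norm (f w) powr p)}"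

definition bergman_norm :: "real \<Rightarrow> (complex^'n) set \<Rightarrow> (complex^'n \<Rightarrow> complex) \<Rightarrow> real"
  where "bergman_norm p \<Omega> f = (LINT w:\<Omega>|lebesgue. norm (f w) powr p) powr (1 / p)"

definition min_norm :: "real \<Rightarrow> (complex^'n) set \<Rightarrow> complex^'n \<Rightarrow> real"
  where "min_norm p \<Omega> z = Inf {bergman_norm p \<Omega> f |f. f \<in> bergman_space p \<Omega> \<and> f z = 1}"

text \<open>
  The unique minimizer \<open>m\<^sub>p(\<zeta>, z) = minimizer p \<Omega> z \<zeta>\<close>; note the order of the arguments.  Functions on
  \<open>\<Omega>\<close> are represented by total functions, so values off \<open>\<Omega>\<close> are fixed to be 0: without that
  normalization \<open>THE\<close> could not denote.
\<close>

definition minimizer :: "real \<Rightarrow> (complex^'n) set \<Rightarrow> complex^'n \<Rightarrow> complex^'n \<Rightarrow> complex"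
  where "minimizer p \<Omega> z =
    (THE m. m \<in> bergman_space p \<Omega> \<and> m z = 1 \<and> bergman_norm p \<Omega> m = min_norm p \<Omega> z
          \<and> (\<forall>w. w \<notin> \<Omega> \<longrightarrow> m w = 0))"

definition bergman_kernel_diag :: "real \<Rightarrow> (complex^'n) set \<Rightarrow> complex^'n \<Rightarrow> real"
  where "bergman_kernel_diag p \<Omega> z = min_norm p \<Omega> z powr (- p)"

definition bergman_kernel :: "real \<Rightarrow> (complex^'n) set \<Rightarrow> complex^'n \<Rightarrow> complex^'n \<Rightarrow> complex"
  where "bergman_kernel p \<Omega> \<zeta> z = minimizer p \<Omega> z \<zeta> * of_real (bergman_kernel_diag p \<Omega> z)"

end

theory Submission
  imports Defs "HOL-Complex_Analysis.Complex_Analysis"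
begin

text \<open>
  Write \<open>m\<close> for the minimizer at \<open>z\<close> and \<open>\<mu>\<close> for its norm.  If \<open>h\<close> lies in the Bergman space and
  \<open>h z = 0\<close>, then every \<open>m + t h\<close> competes with \<open>m\<close>, so \<open>t \<mapsto> \<integral> |m + t h|^p\<close> is least at \<open>t = 0\<close>.  Its
  derivative there in direction \<open>c h\<close> is \<open>p Re (c \<integral> |m|^(p-2) cnj m h)\<close>, and this is nonnegative for all
  complex \<open>c\<close> only if \<open>\<integral> |m|^(p-2) cnj m h = 0\<close>.  The formula follows by applying this to
  \<open>h = f - f(z) m\<close>, because \<open>|m|^(p-2) cnj m m = |m|^p\<close> integrates to \<open>\<mu>^p\<close>.

  Differentiation under the integral (\<open>bergman_minimizer_variation\<close>) rests on convexity: the function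
  \<open>t \<mapsto> |a + t b|^p\<close> is convex, so its difference quotients on \<open>(0, 1]\<close> lie between two fixed integrable
  bounds.  It is differentiable at \<open>0\<close> where \<open>a \<noteq> 0\<close>; for \<open>p = 1\<close> it has a corner where \<open>a = 0\<close>, so the zero
  set of \<open>m\<close> has to be a null set (\<open>negligible_zeros_holomorphic_several\<close>).  For this, look at the zeros
  from a nearby point \<open>b\<close> with \<open>m b \<noteq> 0\<close>.  By the one-variable identity theorem each ray from \<open>b\<close> contains
  only finitely many zeros of a compact neighbourhood, whereas a compact set of positive measure has,
  under infinitely many dilations about \<open>b\<close> with factors tending to \<open>1\<close>, images with a point common to
  infinitely many of them.

  That \<open>m\<close> exists (\<open>bergman_minimizer_exists\<close>) is a normal family argument.  Rotation invariance of
  Lebesgue measure turns the mean value property on circles into \<open>ball_mean_value_le\<close>, so a bound on the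
  norm bounds functions locally uniformly; Cauchy estimates along complex lines then give a pointwise
  convergent subsequence of a minimizing sequence with holomorphic limit
  (\<open>locally_bounded_convergent_subsequence\<close>), and Fatou's lemma shows that the limit is a minimizer.
  This covers \<open>p = 1\<close>, where uniform convexity fails.

  That \<open>m\<close> is unique (\<open>bergman_minimizer_unique\<close>) comes from the equality case of the triangle inequality,
  again for every \<open>p \<ge> 1\<close>.  The midpoint of two minimizers \<open>f\<close>, \<open>g\<close> is a minimizer, and integrating the
  pointwise convexity inequality forces \<open>|f + g| = |f| + |g|\<close> everywhere.  So \<open>g / f\<close> is real near \<open>z\<close>,
  hence constant with value \<open>1\<close> by the open mapping theorem, and the identity theorem gives \<open>f = g\<close>.
\<close>

section \<open>Restriction to complex lines\<close>

lemma norm_cvec_scale: "norm (c *s x) = norm c * norm (x :: complex^'n)"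
  by (simp add: norm_vec_def L2_set_def norm_mult power_mult_distrib real_sqrt_mult
      flip: sum_distrib_left)

lemma scaleR_eq_cvec_scale: "r *\<^sub>R (x :: complex^'n) = of_real r *s x"
  by (simp add: vec_eq_iff scaleR_conv_of_real[where 'a = complex])

lemma bounded_linear_cvec_scale_left: "bounded_linear (\<lambda>t::complex. t *s (v :: complex^'n))"
  by (rule bounded_linear_intro[where K = "norm v"])
     (simp_all add: norm_cvec_scale vec_eq_iff algebra_simps)

lemma bounded_linear_cvec_scale_right: "bounded_linear (\<lambda>v :: complex^'n. t *s v)"
  by (rule bounded_linear_intro[where K = "norm t"])
     (simp_all add: norm_cvec_scale vec_eq_iff algebra_simps)

lemma continuous_on_complex_line:
  "continuous_on A (\<lambda>t::complex. w + t *s (v :: complex^'n))"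
  by (intro continuous_intros linear_continuous_on bounded_linear_cvec_scale_left)

lemma open_complex_line_preimage:
  assumes "open S" shows "open {t::complex. w + t *s (v :: complex^'n) \<in> S}"
  using continuous_open_vimage[OF assms, of "\<lambda>t. w + t *s v"] continuous_on_complex_line[of UNIV w v]
  by (simp add: vimage_def continuous_on_eq_continuous_at)

lemma convex_complex_line_preimage:
  assumes "convex S" shows "convex {t::complex. w + t *s (v :: complex^'n) \<in> S}"
proof (rule convexI, safe)
  fix a b and x y :: real
  assume *: "w + a *s v \<in> S" "w + b *s v \<in> S" "0 \<le> x" "0 \<le> y" "x + y = 1"
  have "x *\<^sub>R (w + a *s v) + y *\<^sub>R (w + b *s v) = (x + y) *\<^sub>R w + (x *\<^sub>R a + y *\<^sub>R b) *s v"
    by (simp add: vec_eq_iff scaleR_conv_of_real[where 'a = complex] algebra_simps)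
  then have "w + (x *\<^sub>R a + y *\<^sub>R b) *s v = x *\<^sub>R (w + a *s v) + y *\<^sub>R (w + b *s v)"
    using \<open>x + y = 1\<close> by simp
  then show "w + (x *\<^sub>R a + y *\<^sub>R b) *s v \<in> S"
    using convexD[OF assms *] by simp
qed

lemma has_field_derivative_complex_line:
  assumes "(f has_derivative D) (at (w + t *s v))" "\<And>c u. D (c *s u) = c * D u"
  shows "((\<lambda>t. f (w + t *s (v :: complex^'n))) has_field_derivative D v) (at t)"
proof -
  have "((\<lambda>t. w + t *s v) has_derivative (\<lambda>h. h *s v)) (at t)"
    using has_derivative_add[OF has_derivative_const
        bounded_linear_imp_has_derivative[OF bounded_linear_cvec_scale_left[of v]]]
    by simp
  from diff_chain_at[OF this assms(1)] show ?thesis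
    by (simp add: has_field_derivative_def o_def assms(2) mult_commute_abs)
qed

text \<open>
  Everything that follows about several variables is reduced to one variable through this restriction.
\<close>

lemma holomorphic_on_complex_line:
  assumes "holomorphic_several_on f \<Omega>" "A \<subseteq> {t. w + t *s v \<in> \<Omega>}"
  shows "(\<lambda>t. f (w + t *s v)) holomorphic_on A"
proof (rule holomorphic_onI)
  fix t assume "t \<in> A"
  then obtain D where "(f has_derivative D) (at (w + t *s v))" "\<And>c u. D (c *s u) = c * D u"
    using assms unfolding holomorphic_several_on_def by blast
  from has_field_derivative_complex_line[OF this]
  show "(\<lambda>t. f (w + t *s v)) field_differentiable at t within A"
    using field_differentiable_at_within field_differentiable_def by blast
qed

lemma holomorphic_several_on_continuous:
  "holomorphic_several_on f \<Omega> \<Longrightarrow> continuous_on \<Omega> f"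
  unfolding holomorphic_several_on_def
  by (meson continuous_at_imp_continuous_on has_derivative_continuous)

lemma holomorphic_several_on_subset:
  "holomorphic_several_on f \<Omega> \<Longrightarrow> A \<subseteq> \<Omega> \<Longrightarrow> holomorphic_several_on f A"
  unfolding holomorphic_several_on_def by blast

lemma holomorphic_several_on_const: "holomorphic_several_on (\<lambda>_. c) \<Omega>"
  unfolding holomorphic_several_on_def
  by (intro ballI exI[of _ "\<lambda>_. 0"]) auto

lemma holomorphic_several_on_add:
  assumes "holomorphic_several_on f \<Omega>" "holomorphic_several_on g \<Omega>"
  shows "holomorphic_several_on (\<lambda>x. f x + g x) \<Omega>"
  unfolding holomorphic_several_on_def
proof
  fix z assume "z \<in> \<Omega>"
  then obtain D E where "(f has_derivative D) (at z)" "\<forall>c u. D (c *s u) = c * D u"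
    "(g has_derivative E) (at z)" "\<forall>c u. E (c *s u) = c * E u"
    using assms unfolding holomorphic_several_on_def by meson
  then show "\<exists>D. ((\<lambda>x. f x + g x) has_derivative D) (at z) \<and> (\<forall>c v. D (c *s v) = c * D v)"
    by (intro exI[of _ "\<lambda>x. D x + E x"]) (auto intro: has_derivative_add simp: algebra_simps)
qed

lemma holomorphic_several_on_cmult:
  assumes "holomorphic_several_on f \<Omega>"
  shows "holomorphic_several_on (\<lambda>x. a * f x) \<Omega>"
  unfolding holomorphic_several_on_def
proof
  fix z assume "z \<in> \<Omega>"
  then obtain D where "(f has_derivative D) (at z)" "\<forall>c u. D (c *s u) = c * D u"
    using assms unfolding holomorphic_several_on_def by meson
  then show "\<exists>D. ((\<lambda>x. a * f x) has_derivative D) (at z) \<and> (\<forall>c v. D (c *s v) = c * D v)"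
    by (intro exI[of _ "\<lambda>x. a * D x"]) (auto intro: has_derivative_mult_right)
qed

lemma holomorphic_several_on_cong:
  assumes "holomorphic_several_on f \<Omega>" "open \<Omega>" "\<And>x. x \<in> \<Omega> \<Longrightarrow> g x = f x"
  shows "holomorphic_several_on g \<Omega>"
  unfolding holomorphic_several_on_def
proof
  fix z assume z: "z \<in> \<Omega>"
  then obtain D where D: "(f has_derivative D) (at z)" "\<forall>c u. D (c *s u) = c * D u"
    using assms unfolding holomorphic_several_on_def by meson
  have "(g has_derivative D) (at z)"
    using has_derivative_transform_within_open[OF D(1) assms(2) z] assms(3) by simp
  with D(2) show "\<exists>D. (g has_derivative D) (at z) \<and> (\<forall>c v. D (c *s v) = c * D v)" by blast
qed

section \<open>Cauchy estimates and the identity theorem\<close>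

text \<open>
  Taylor's formula of order 0 and 1, with the derivatives on the disc of radius \<open>R/2\<close> bounded by
  Cauchy's inequality on circles of radius \<open>R/4\<close>.
\<close>

lemma Cauchy_estimates_disc:
  fixes g :: "complex \<Rightarrow> complex"
  assumes g: "g holomorphic_on ball 0 R" and R: "0 < R"
    and M: "\<And>x. x \<in> ball 0 R \<Longrightarrow> norm (g x) \<le> M" and s: "norm s \<le> R / 2"
  shows "norm (g s - g 0) \<le> 4 * M / R * norm s"
    and "norm (g s - g 0 - deriv g 0 * s) \<le> 32 * M / R^2 * norm s ^ 2"
proof -
  have D: "((deriv ^^ i) g has_field_derivative (deriv ^^ Suc i) g x) (at x within cball 0 (R/2))"
    if "x \<in> cball 0 (R/2)" for i x
  proof -
    have "(deriv ^^ i) g holomorphic_on ball 0 R"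
      by (intro holomorphic_higher_deriv g) auto
    moreover have "x \<in> ball 0 R" using that R by auto
    ultimately show ?thesis
      by (simp add: holomorphic_derivI has_field_derivative_at_within)
  qed
  have B: "norm ((deriv ^^ n) g x) \<le> fact n * M / (R/4)^n" if "x \<in> cball 0 (R/2)" for n x
  proof (rule Cauchy_inequality)
    have sub: "cball x (R/4) \<subseteq> ball 0 R"
    proof
      fix y assume "y \<in> cball x (R/4)"
      then show "y \<in> ball 0 R"
        using that R norm_triangle_ineq[of x "y - x"] by (auto simp: dist_norm norm_minus_commute)
    qed
    then show "g holomorphic_on ball x (R/4)"
      using g holomorphic_on_subset ball_subset_cball by (meson order_trans)
    show "continuous_on (cball x (R/4)) g"
      using g sub continuous_on_subset holomorphic_on_imp_continuous_on by blast
    show "0 < R/4" using R by simp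
    show "norm (g y) \<le> M" if "norm (x - y) = R/4" for y
      using that sub M[of y] by (auto simp: dist_norm subset_iff)
  qed
  have conv: "convex (cball (0::complex) (R/2))" "0 \<in> cball (0::complex) (R/2)" "s \<in> cball 0 (R/2)"
    using R s by auto
  have "norm ((deriv ^^ 0) g s - (\<Sum>i\<le>0. (deriv ^^ i) g 0 * (s-0) ^ i / fact i))
      \<le> (4*M/R) * norm (s - 0) ^ Suc 0 / fact 0"
  proof (rule complex_Taylor[OF conv(1) _ _ conv(2,3)])
    fix x assume "x \<in> cball (0::complex) (R/2)"
    from B[OF this, of 1] show "cmod ((deriv ^^ Suc 0) g x) \<le> 4 * M / R" by (simp add: mult.commute)
  qed (use D[of _ 0] in auto)
  then show "norm (g s - g 0) \<le> 4 * M / R * norm s" by simp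
  have "norm ((deriv ^^ 0) g s - (\<Sum>i\<le>1. (deriv ^^ i) g 0 * (s-0) ^ i / fact i))
      \<le> (32*M/R^2) * norm (s - 0) ^ Suc 1 / fact 1"
  proof (rule complex_Taylor[OF conv(1) _ _ conv(2,3)])
    fix x assume "x \<in> cball (0::complex) (R/2)"
    from B[OF this, of 2] show "cmod ((deriv ^^ Suc 1) g x) \<le> 32 * M / R^2"
      by (simp add: power2_eq_square eval_nat_numeral)
  qed (use D in blast)
  then show "norm (g s - g 0 - deriv g 0 * s) \<le> 32 * M / R^2 * norm s ^ 2"
    by (simp add: algebra_simps power2_eq_square)
qed

text \<open>
  The constants depend only on the bound \<open>M\<close> and the radius.  The first estimate makes locally bounded
  families equicontinuous, the second carries differentiability over to pointwise limits.
\<close>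

lemma Cauchy_estimates_ball:
  fixes f :: "complex^'n \<Rightarrow> complex"
  assumes f: "holomorphic_several_on f (ball w R)" and R: "0 < R"
    and M: "\<And>x. x \<in> ball w R \<Longrightarrow> norm (f x) \<le> M" and h: "norm h \<le> R / 2"
  shows "norm (f (w + h) - f w) \<le> 4 * M / R * norm h"
    and "\<lbrakk>(f has_derivative D) (at w); \<And>c v. D (c *s v) = c * D v\<rbrakk>
      \<Longrightarrow> norm (f (w + h) - f w - D h) \<le> 32 * M / R^2 * norm h ^ 2"
proof -
  let ?g = "\<lambda>t. f (w + t *s h)"
  have in_ball: "w + t *s h \<in> ball w R" if "t \<in> ball 0 (R / norm h)" "h \<noteq> 0" for t
    using that by (simp add: dist_norm norm_cvec_scale field_simps)
  have hol: "?g holomorphic_on ball 0 (R / norm h)" if "h \<noteq> 0"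
    by (rule holomorphic_on_complex_line[OF f]) (use in_ball that in auto)
  note est = Cauchy_estimates_disc[OF hol, of M 1]
  show "norm (f (w + h) - f w) \<le> 4 * M / R * norm h"
  proof (cases "h = 0")
    case False
    then have "norm (?g 1 - ?g 0) \<le> 4 * M / (R / norm h) * norm (1::complex)"
      using h R in_ball by (intro est(1) M) (auto simp: field_simps)
    then show ?thesis by simp
  qed simp
  assume D: "(f has_derivative D) (at w)" "\<And>c v. D (c *s v) = c * D v"
  show "norm (f (w + h) - f w - D h) \<le> 32 * M / R^2 * norm h ^ 2"
  proof (cases "h = 0")
    case True
    then show ?thesis using D(2)[of 0 0] by simp
  next
    case False
    have "(?g has_field_derivative D h) (at 0)"
      by (rule has_field_derivative_complex_line) (use D in auto)
    then have "deriv ?g 0 = D h" by (rule DERIV_imp_deriv)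
    moreover have "norm (?g 1 - ?g 0 - deriv ?g 0 * 1) \<le> 32 * M / (R / norm h)^2 * norm (1::complex)^2"
      using h R in_ball False by (intro est(2) M) (auto simp: field_simps)
    ultimately show ?thesis by (simp add: power_divide)
  qed
qed

text \<open>
  The complex line through \<open>y\<close> and \<open>u\<close> meets the ball in a convex set, and the restriction of \<open>f\<close> to it
  vanishes near \<open>y\<close>.
\<close>

lemma holomorphic_several_zero_on_ball:
  fixes f :: "complex^'n \<Rightarrow> complex"
  assumes f: "holomorphic_several_on f (ball x e)" and y: "y \<in> ball x e" and d: "0 < d"
    and zero: "\<And>v. v \<in> ball y d \<Longrightarrow> f v = 0" and u: "u \<in> ball x e"
  shows "f u = 0"
proof -
  let ?L = "\<lambda>t. y + t *s (u - y)"
  let ?S = "{t. ?L t \<in> ball x e}"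
  let ?U = "{t. ?L t \<in> ball x e \<inter> ball y d}"
  have "open ?U" by (intro open_complex_line_preimage) auto
  moreover have "0 \<in> ?U" using y d by simp
  ultimately have lim: "0 islimpt ?U" by (metis interior_limit_point interior_open)
  have "f (?L 1) = 0"
  proof (rule analytic_continuation[of "\<lambda>t. f (?L t)" ?S ?U 0])
    show "(\<lambda>t. f (?L t)) holomorphic_on ?S"
      by (rule holomorphic_on_complex_line[OF f]) auto
    show "open ?S" by (intro open_complex_line_preimage) auto
    show "connected ?S" by (intro convex_connected convex_complex_line_preimage) auto
  qed (use lim u y zero in auto)
  then show ?thesis by simp
qed

text \<open>
  The interior of the zero set is relatively closed: a ball about a point outside it contains none of
  its points, since otherwise \<open>f\<close> would vanish on the whole ball.
\<close>

theorem holomorphic_several_identity: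
  fixes f :: "complex^'n \<Rightarrow> complex"
  assumes f: "holomorphic_several_on f \<Omega>" and \<Omega>: "open \<Omega>" "connected \<Omega>"
    and d: "0 < d" and sub: "ball a d \<subseteq> \<Omega>" and zero: "\<And>v. v \<in> ball a d \<Longrightarrow> f v = 0"
    and u: "u \<in> \<Omega>"
  shows "f u = 0"
proof -
  let ?U = "interior {x \<in> \<Omega>. f x = 0}"
  have sub': "?U \<subseteq> \<Omega>" using interior_subset by blast
  have "open (\<Omega> - ?U)"
  proof (rule openI)
    fix x assume x: "x \<in> \<Omega> - ?U"
    then obtain e where e: "0 < e" "ball x e \<subseteq> \<Omega>" using \<Omega>(1) by (auto simp: open_contains_ball)
    have fe: "holomorphic_several_on f (ball x e)"
      using holomorphic_several_on_subset f e by blast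
    have "ball x e \<inter> ?U = {}"
    proof (rule ccontr)
      assume "ball x e \<inter> ?U \<noteq> {}"
      then obtain y d' where y: "y \<in> ball x e" "0 < d'" "ball y d' \<subseteq> {x \<in> \<Omega>. f x = 0}"
        by (auto simp: mem_interior)
      then have "f v = 0" if "v \<in> ball x e" for v
        using holomorphic_several_zero_on_ball[OF fe y(1,2) _ that] by blast
      then have "ball x e \<subseteq> {x \<in> \<Omega>. f x = 0}" using e by blast
      then have "x \<in> ?U" using e(1) mem_interior by blast
      then show False using x by simp
    qed
    then show "\<exists>T>0. ball x T \<subseteq> \<Omega> - ?U" using e by blast
  qed
  then have "closedin (top_of_set \<Omega>) ?U"
    using sub' by (metis Diff_Diff_Int Int_absorb1 Diff_subset closedin_def open_openin openin_open_eq
        topspace_euclidean_subtopology \<Omega>(1) closedin_subset inf.absorb_iff2)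
  moreover have "openin (top_of_set \<Omega>) ?U" using sub' \<Omega>(1) by (simp add: openin_open_eq)
  moreover have "?U \<noteq> {}"
  proof -
    have "ball a d \<subseteq> {x \<in> \<Omega>. f x = 0}" using sub zero by blast
    then have "a \<in> ?U" using d mem_interior by blast
    then show ?thesis by blast
  qed
  ultimately have "?U = \<Omega>" using \<Omega>(2) unfolding connected_clopen by blast
  then show ?thesis using u interior_subset by blast
qed

section \<open>Zero sets have measure zero\<close>

text \<open>
  A counterpart of the Borel--Cantelli lemma: by continuity from above, the limit superior of the sets has
  measure at least \<open>c\<close>.
\<close>

lemma infinitely_often_of_measure_bounded_below:
  assumes A: "\<And>n::nat. A n \<in> fmeasurable M" and sub: "\<And>n. A n \<subseteq> C" and C: "C \<in> fmeasurable M"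
    and c: "0 < c" "\<And>n. c \<le> measure M (A n)"
  shows "\<exists>x. \<exists>\<^sub>\<infinity>n. x \<in> A n"
proof -
  let ?B = "\<lambda>N. \<Union>n\<in>{N..}. A n"
  have sets: "?B N \<in> sets M" for N
    using A by (intro sets.countable_UN') (auto dest: fmeasurableD)
  have sets': "?B N \<in> fmeasurable M" for N
    by (rule fmeasurableI2[OF C]) (use sub sets in auto)
  have "(\<lambda>N. measure M (?B N)) \<longlonglongrightarrow> measure M (\<Inter>N. ?B N)"
  proof (rule Lim_measure_decseq)
    show "decseq ?B" unfolding decseq_def by (intro allI impI UN_mono) auto
    show "emeasure M (?B N) \<noteq> \<infinity>" for N
      using sets'[of N] by (auto simp: fmeasurable_def top.not_eq_extremum)
  qed (use sets in auto)
  moreover have "c \<le> measure M (?B N)" for N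
    using c(2)[of N] measure_mono_fmeasurable[of "A N" "?B N" M] A sets' by (fastforce dest: fmeasurableD)
  ultimately have "c \<le> measure M (\<Inter>N. ?B N)"
    by (intro LIMSEQ_le_const) auto
  then have "(\<Inter>N. ?B N) \<noteq> {}" using c(1) by auto
  then obtain x where "x \<in> (\<Inter>N. ?B N)" by blast
  then have "\<forall>N. \<exists>n\<ge>N. x \<in> A n" by (auto simp: Bex_def)
  then show ?thesis unfolding INFM_nat_le by blast
qed

text \<open>
  The contractions of \<open>E\<close> towards \<open>b\<close> by factors \<open>1 / s n\<close> increasing to 1 stay in a bounded set and keep
  a fixed fraction of the measure of \<open>E\<close>, so if \<open>E\<close> is not null, some \<open>x\<close> lies in infinitely many of
  them.  Then \<open>b + s n (x - b) \<in> E\<close> for infinitely many \<open>n\<close>, and \<open>x \<in> E\<close> because \<open>E\<close> is closed, so the ray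
  through \<open>x\<close> meets \<open>E\<close> infinitely often.
\<close>

lemma negligible_compact_finite_on_rays:
  fixes E :: "'a::euclidean_space set"
  assumes E: "compact E"
    and fin: "\<And>x. x \<in> E \<Longrightarrow> finite {t \<in> {1..2}. b + t *\<^sub>R (x - b) \<in> E}"
  shows "negligible E"
proof (rule ccontr)
  assume neg: "\<not> negligible E"
  \<comment> \<open>Inverses of the contraction factors: distinct, between 1 and 2, and tending to 1.\<close>
  define s where "s n = 1 + 1 / real (Suc n)" for n
  have s: "1 < s n" "s n \<le> 2" for n by (auto simp: s_def field_simps)
  have inj_s: "inj s" by (auto simp: inj_def s_def)
  have s_lim: "s \<longlonglongrightarrow> 1"
    unfolding s_def using tendsto_add[OF tendsto_const[of 1] LIMSEQ_inverse_real_of_nat]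
    by (simp add: inverse_eq_divide)
  define A where "A n = (\<lambda>e. (1 / s n) *\<^sub>R e + (b - (1 / s n) *\<^sub>R b)) ` E" for n
  have mem_A: "b + s n *\<^sub>R (x - b) \<in> E" if "x \<in> A n" for x n
  proof -
    obtain e where "e \<in> E" "x = (1 / s n) *\<^sub>R e + (b - (1 / s n) *\<^sub>R b)"
      using \<open>x \<in> A n\<close> unfolding A_def by blast
    moreover from this s[of n] have "b + s n *\<^sub>R (x - b) = e"
      by (simp add: scaleR_right_diff_distrib scaleR_right_distrib)
    ultimately show ?thesis by simp
  qed
  have lmE: "E \<in> lmeasurable" using E by (rule lmeasurable_compact)
  have pos: "0 < measure lebesgue E"
    using neg lmE by (simp add: negligible_iff_measure0 zero_less_measure_iff)
  have cA: "compact (A n)" for n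
    unfolding A_def by (intro compact_continuous_image continuous_intros E)
  obtain r where r: "\<And>e. e \<in> E \<Longrightarrow> norm (e - b) \<le> r"
    using compact_imp_bounded[OF E] unfolding bounded_iff
    by (metis add_mono_thms_linordered_semiring(1) norm_triangle_ineq4 order_refl order_trans)
  have sub: "A n \<subseteq> cball b r" for n
  proof
    fix x assume x: "x \<in> A n"
    have "norm (x - b) \<le> s n * norm (x - b)"
      using s[of n] by (simp add: mult_le_cancel_right1)
    also have "\<dots> = norm (b + s n *\<^sub>R (x - b) - b)"
      using s[of n] by simp
    also have "\<dots> \<le> r" by (rule r[OF mem_A[OF x]])
    finally show "x \<in> cball b r" by (simp add: dist_norm norm_minus_commute)
  qed
  have meas: "(1/2) ^ DIM('a) * measure lebesgue E \<le> measure lebesgue (A n)" for n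
  proof -
    have "measure lebesgue (A n) = \<bar>1 / s n\<bar> ^ DIM('a) * measure lebesgue E"
      unfolding A_def by (rule measure_lebesgue_affine)
    moreover have "(1/2) ^ DIM('a) \<le> \<bar>1 / s n\<bar> ^ DIM('a)"
      using s[of n] by (intro power_mono) (auto simp: field_simps)
    ultimately show ?thesis by (simp add: mult_right_mono)
  qed
  have "\<exists>x. \<exists>\<^sub>\<infinity>n. x \<in> A n"
    by (rule infinitely_often_of_measure_bounded_below[where M = lebesgue and C = "cball b r"
          and c = "(1/2) ^ DIM('a) * measure lebesgue E"])
       (use cA sub pos meas in \<open>auto intro: lmeasurable_compact\<close>)
  then obtain x where x: "infinite {n. x \<in> A n}" by (auto simp: frequently_cofinite)
  obtain k :: "nat \<Rightarrow> nat" where k: "strict_mono k" "\<And>n. k n \<in> {n. x \<in> A n}"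
    using infinite_enumerate[OF x] by blast
  have "(\<lambda>n. b + s (k n) *\<^sub>R (x - b)) \<longlonglongrightarrow> b + 1 *\<^sub>R (x - b)"
    using LIMSEQ_subseq_LIMSEQ[OF s_lim k(1)] by (intro tendsto_intros) (simp add: o_def)
  then have "x \<in> E"
    using closed_sequentially[OF compact_imp_closed[OF E], of "\<lambda>n. b + s (k n) *\<^sub>R (x - b)"]
      mem_A k(2) by simp
  then have "finite {t \<in> {1..2}. b + t *\<^sub>R (x - b) \<in> E}" by (rule fin)
  moreover have "s ` {n. x \<in> A n} \<subseteq> {t \<in> {1..2}. b + t *\<^sub>R (x - b) \<in> E}"
    using s mem_A by (auto simp: less_imp_le)
  moreover have "infinite (s ` {n. x \<in> A n})"
    using x inj_s by (metis finite_imageD inj_on_subset subset_UNIV)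
  ultimately show False using finite_subset by blast
qed

theorem negligible_zeros_holomorphic_several:
  fixes f :: "complex^'n \<Rightarrow> complex"
  assumes f: "holomorphic_several_on f \<Omega>" and \<Omega>: "open \<Omega>" "connected \<Omega>"
    and z: "z \<in> \<Omega>" "f z \<noteq> 0"
  shows "negligible {w \<in> \<Omega>. f w = 0}"
proof (subst locally_negligible_alt, rule ballI)
  let ?Z = "{w \<in> \<Omega>. f w = 0}"
  fix a assume a: "a \<in> ?Z"
  then obtain R where R: "0 < R" "ball a R \<subseteq> \<Omega>" using \<Omega>(1) by (auto simp: open_contains_ball)
  obtain b where b: "b \<in> ball a R" "f b \<noteq> 0"
    using holomorphic_several_identity[OF f \<Omega> R] z by blast
  let ?E = "{w \<in> cball a (R/2). f w = 0}"
  have sub: "cball a (R/2) \<subseteq> ball a R" using R by auto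
  have E: "compact ?E"
  proof -
    have "continuous_on (cball a (R/2)) f"
      using continuous_on_subset[OF holomorphic_several_on_continuous[OF f]] sub R by blast
    then have "closed ?E"
      by (rule continuous_closed_preimage_constant) simp
    moreover have "bounded ?E"
      by (rule bounded_subset[OF bounded_cball[of a "R/2"]]) auto
    ultimately show ?thesis by (simp add: compact_eq_bounded_closed)
  qed
  have "negligible ?E"
  proof (rule negligible_compact_finite_on_rays[OF E, of b], rule ccontr)
    fix x assume x: "x \<in> ?E"
    let ?T = "{t \<in> {1..2}. b + t *\<^sub>R (x - b) \<in> ?E}"
    let ?S = "{t. b + t *s (x - b) \<in> ball a R}"
    assume inf: "infinite ?T"
    have "closed {t. b + t *\<^sub>R (x - b) \<in> ?E}"
      using continuous_closed_vimage[OF compact_imp_closed[OF E], of "\<lambda>t. b + t *\<^sub>R (x - b)"]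
      by (simp add: vimage_def)
    then have "compact ({1..2} \<inter> {t. b + t *\<^sub>R (x - b) \<in> ?E})"
      by (intro compact_Int_closed) auto
    moreover have "?T = {1..2} \<inter> {t. b + t *\<^sub>R (x - b) \<in> ?E}" by blast
    ultimately have "compact ?T" by simp
    then have "compact (of_real ` ?T :: complex set)"
      by (intro compact_continuous_image continuous_intros)
    moreover have "infinite (of_real ` ?T :: complex set)"
      using inf by (metis (no_types, lifting) finite_imageD inj_of_real inj_on_subset subset_UNIV)
    \<comment> \<open>The zeros accumulate at a point of the line that is still inside the ball, as \<open>?T\<close> is compact.\<close>
    ultimately obtain \<xi> :: complex where \<xi>: "\<xi> \<in> of_real ` ?T" "\<xi> islimpt of_real ` ?T"
      unfolding compact_eq_Bolzano_Weierstrass by blast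
    have TS: "of_real ` ?T \<subseteq> ?S"
      using sub by (auto simp: scaleR_eq_cvec_scale)
    have "f (b + 0 *s (x - b)) = 0"
    proof (rule analytic_continuation[of "\<lambda>t. f (b + t *s (x - b))" ?S "of_real ` ?T" \<xi>])
      show "(\<lambda>t. f (b + t *s (x - b))) holomorphic_on ?S"
        by (rule holomorphic_on_complex_line[OF f]) (use R in auto)
      show "open ?S" by (intro open_complex_line_preimage) auto
      show "connected ?S" by (intro convex_connected convex_complex_line_preimage) auto
      show "f (b + t *s (x - b)) = 0" if "t \<in> of_real ` ?T" for t
        using that by (auto simp: scaleR_eq_cvec_scale)
    qed (use \<xi> TS b in auto)
    then show False using b by simp
  qed
  then have "negligible (?Z \<inter> ball a (R/2))"
    by (rule negligible_subset) auto
  moreover have "openin (top_of_set ?Z) (?Z \<inter> ball a (R/2))" by auto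
  ultimately show "\<exists>U. openin (top_of_set ?Z) U \<and> a \<in> U \<and> negligible U"
    using a R(1) by (intro exI[of _ "?Z \<inter> ball a (R/2)"]) auto
qed

section \<open>Rotation invariance of Lebesgue measure\<close>

text \<open>
  A choice of bijection between a basis and an index type identifies a Euclidean space with a space of
  real vectors; boxes correspond to boxes of the same volume.
\<close>

lemma distr_lborel_coordinates:
  fixes h :: "'a::euclidean_space \<Rightarrow> 'm::finite"
  assumes h: "bij_betw h Basis UNIV"
  shows "distr lborel borel (\<lambda>x :: real^'m. \<Sum>b\<in>Basis. (x $ h b) *\<^sub>R b) = lborel"
    (is "distr _ _ ?T = _")
proof (rule lborel_eqI[symmetric])
  fix l u :: 'a assume le: "\<And>b. b \<in> Basis \<Longrightarrow> l \<bullet> b \<le> u \<bullet> b"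
  define k where "k = inv_into Basis h"
  have k: "k j \<in> Basis" "h (k j) = j" for j
    using h by (auto simp: k_def bij_betw_def inv_into_into f_inv_into_f)
  have kh: "k (h b) = b" if "b \<in> Basis" for b
    using h that by (simp add: k_def bij_betw_inv_into_left)
  have bk: "bij_betw k UNIV Basis"
    unfolding k_def by (rule bij_betw_inv_into[OF h])
  have axis: "bij_betw (\<lambda>j. axis j 1) UNIV (Basis :: (real^'m) set)"
    by (auto simp: bij_betw_def inj_def axis_eq_axis Basis_vec_def)
  have T: "?T x \<bullet> b = x $ h b" if "b \<in> Basis" for x b
    using that by (simp add: inner_sum_left inner_Basis if_distrib cong: if_cong)
  have vim: "?T -` box l u = box (\<chi> j. l \<bullet> k j) (\<chi> j. u \<bullet> k j)"
  proof (intro set_eqI iffI)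
    fix x assume "x \<in> ?T -` box l u"
    then have "l \<bullet> k j < ?T x \<bullet> k j \<and> ?T x \<bullet> k j < u \<bullet> k j" for j
      using k(1) by (simp only: vimage_eq mem_box)
    then show "x \<in> box (\<chi> j. l \<bullet> k j) (\<chi> j. u \<bullet> k j)"
      using T[OF k(1)] by (auto simp: mem_box_cart k(2))
  next
    fix x assume "x \<in> box (\<chi> j. l \<bullet> k j) (\<chi> j. u \<bullet> k j)"
    then have "l \<bullet> k j < x $ j \<and> x $ j < u \<bullet> k j" for j by (auto simp: mem_box_cart)
    then show "x \<in> ?T -` box l u" using kh T by (simp only: vimage_eq mem_box) metis
  qed
  have meas: "?T \<in> borel_measurable lborel"
    using borel_measurable_continuous_onI[of ?T] by (simp add: continuous_intros)
  have "emeasure (distr lborel borel ?T) (box l u) = emeasure lborel (box (\<chi> j. l \<bullet> k j) (\<chi> j. u \<bullet> k j) :: (real^'m) set)"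
    using meas vim by (subst emeasure_distr) auto
  also have "\<dots> = (\<Prod>b\<in>Basis. ((\<chi> j. u \<bullet> k j) - (\<chi> j. l \<bullet> k j)) \<bullet> (b :: real^'m))"
    using le k by (subst emeasure_lborel_box) (auto simp: Basis_vec_def inner_axis)
  also have "\<dots> = (\<Prod>j\<in>UNIV. (u - l) \<bullet> k j)"
    by (subst prod.reindex_bij_betw[OF axis, symmetric]) (simp add: inner_axis inner_diff_left)
  also have "\<dots> = (\<Prod>b\<in>Basis. (u - l) \<bullet> b)"
    by (subst prod.reindex_bij_betw[OF bk, symmetric]) simp
  finally show "emeasure (distr lborel borel ?T) (box l u) = (\<Prod>b\<in>Basis. (u - l) \<bullet> b)" .
qed simp

lemma distr_lborel_orthogonal_cart:
  fixes R :: "real^'m::{finite,wellorder} \<Rightarrow> real^'m::_"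
  assumes R: "orthogonal_transformation R"
  shows "distr lborel borel R = lborel"
proof (rule lborel_eqI[symmetric])
  fix l u :: "real^'m::{finite,wellorder}" assume le: "\<And>b. b \<in> Basis \<Longrightarrow> l \<bullet> b \<le> u \<bullet> b"
  have inv: "orthogonal_transformation (inv R)"
    using R by (rule orthogonal_transformation_inv)
  have vim: "R -` box l u = inv R ` box l u"
    using orthogonal_transformation_bij[OF R] by (simp add: bij_vimage_eq_inv_image)
  have lm: "box l u \<in> lmeasurable" by simp
  have meas: "R \<in> borel_measurable borel"
    by (intro borel_measurable_continuous_onI linear_continuous_on)
       (use R orthogonal_transformation_linear linear_conv_bounded_linear in blast)
  then have sets: "R -` box l u \<in> sets lborel"
    using measurable_sets[of R borel borel "box l u"] by simp
  have "emeasure (distr lborel borel R) (box l u) = emeasure lborel (R -` box l u)"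
    using meas by (subst emeasure_distr) auto
  also have "\<dots> = emeasure lebesgue (R -` box l u)"
    using sets by simp
  also have "\<dots> = emeasure lebesgue (inv R ` box l u)" by (simp add: vim)
  also have "\<dots> = ennreal (measure lebesgue (box l u))"
    using measurable_orthogonal_image[OF inv lm] measure_orthogonal_image[OF inv lm]
    by (simp add: emeasure_eq_measure2)
  also have "\<dots> = emeasure lborel (box l u)"
    using lm by (simp add: emeasure_eq_measure2)
  also have "\<dots> = (\<Prod>b\<in>Basis. (u - l) \<bullet> b)"
    using le by (simp add: emeasure_lborel_box)
  finally show "emeasure (distr lborel borel R) (box l u) = (\<Prod>b\<in>Basis. (u - l) \<bullet> b)" .
qed simp

text \<open>
  The change of variables theorem speaks about \<open>real^'m\<close> with a well-ordered index type.  The type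
  \<open>'n bit0\<close> is well-ordered and has \<open>2 * CARD('n)\<close> elements, which is the real dimension of \<open>complex^'n\<close>, so
  an orthogonal map can be conjugated to one of \<open>real^('n bit0)\<close>.
\<close>

lemma distr_lborel_orthogonal:
  fixes R :: "complex^'n \<Rightarrow> complex^'n"
  assumes R: "orthogonal_transformation R"
  shows "distr lborel borel R = lborel"
proof -
  have "card (Basis :: (complex^'n) set) = card (UNIV :: 'n bit0 set)" by simp
  then obtain h :: "complex^'n \<Rightarrow> 'n bit0" where h: "bij_betw h Basis UNIV"
    by (metis finite_Basis finite bij_betw_iff_card)
  define T where "T = (\<lambda>x :: real^('n bit0). \<Sum>b\<in>Basis. (x $ h b) *\<^sub>R b)"
  have dT: "distr lborel borel T = lborel" unfolding T_def by (rule distr_lborel_coordinates[OF h])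
  define S :: "complex^'n \<Rightarrow> real^('n bit0)" where "S = (\<lambda>y. \<chi> j. y \<bullet> inv_into Basis h j)"
  have hb: "inv_into Basis h (h b) = b" if "b \<in> Basis" for b
    using h that by (simp add: bij_betw_inv_into_left)
  have TS: "T (S y) = y" for y
    unfolding T_def S_def by (simp add: hb euclidean_representation)
  have Tin: "T x \<bullet> b = x $ h b" if "b \<in> Basis" for x b
    using that by (simp add: T_def inner_sum_left inner_Basis if_distrib cong: if_cong)
  have inner_T: "T x \<bullet> T y = x \<bullet> y" for x y
  proof -
    have "T x \<bullet> T y = (\<Sum>b\<in>Basis. (T x \<bullet> b) * (T y \<bullet> b))" by (rule euclidean_inner)
    also have "\<dots> = (\<Sum>b\<in>Basis. x $ h b * y $ h b)" by (simp add: Tin)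
    also have "\<dots> = (\<Sum>j\<in>UNIV. x $ j * y $ j)" by (rule sum.reindex_bij_betw[OF h])
    finally show ?thesis by (simp add: inner_vec_def)
  qed
  have linT: "linear T" unfolding T_def by (auto intro!: linearI simp: scaleR_add_left sum.distrib scaleR_sum_right)
  have linS: "linear S" unfolding S_def by (auto intro!: linearI simp: vec_eq_iff inner_add_left)
  have linR: "linear R" using R by (rule orthogonal_transformation_linear)
  have inner_S: "S x \<bullet> S y = x \<bullet> y" for x y using inner_T[of "S x" "S y"] by (simp add: TS)
  have inner_R: "R x \<bullet> R y = x \<bullet> y" for x y
    using R by (simp add: orthogonal_transformation_def)
  define R' where "R' = S \<circ> R \<circ> T"
  have R': "orthogonal_transformation R'"
    unfolding orthogonal_transformation_def R'_def
    using linT linS linR by (auto simp: linear_compose inner_S inner_R inner_T)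
  have TR': "T \<circ> R' = R \<circ> T" by (auto simp: R'_def TS)
  have meas: "f \<in> borel_measurable borel" if "linear f" for f :: "'x::euclidean_space \<Rightarrow> 'y::euclidean_space"
    using that by (intro borel_measurable_continuous_onI linear_continuous_on) (simp add: linear_conv_bounded_linear)
  have linR': "linear R'" using R' by (rule orthogonal_transformation_linear)
  have "distr lborel borel R = distr (distr lborel borel T) borel R" by (simp add: dT)
  also have "\<dots> = distr lborel borel (T \<circ> R')"
    by (subst distr_distr) (use meas linT linR in \<open>auto simp: TR'\<close>)
  also have "\<dots> = distr (distr lborel borel R') borel T"
    by (subst distr_distr) (use meas linT linR' in auto)
  also have "\<dots> = lborel" by (simp add: distr_lborel_orthogonal_cart[OF R'] dT)
  finally show ?thesis .
qed

lemma distr_lborel_cvec_scale: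
  assumes "norm c = 1"
  shows "distr lborel borel (\<lambda>u :: complex^'n. c *s u) = lborel"
proof (rule distr_lborel_orthogonal)
  show "orthogonal_transformation (\<lambda>u :: complex^'n. c *s u)"
    unfolding orthogonal_transformation
    using assms bounded_linear_cvec_scale_right[of c]
    by (simp add: norm_cvec_scale linear_conv_bounded_linear)
qed

section \<open>The mean value inequality on balls\<close>

lemma circle_mean_value_le:
  assumes g: "g holomorphic_on A" and A: "open A" "cball 0 1 \<subseteq> A"
  shows "ennreal (2 * pi * norm (g 0)) \<le> (\<integral>\<^sup>+t\<in>{0..2*pi}. norm (g (cis t)) \<partial>lborel)"
proof -
  have cont: "continuous_on (cball 0 1) g"
    using g A continuous_on_subset holomorphic_on_imp_continuous_on by blast
  have "((\<lambda>u. g u / (u - 0)) has_contour_integral (2 * of_real pi * \<i> * g 0)) (circlepath 0 1)"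
  proof (rule Cauchy_integral_circlepath[OF cont])
    show "g holomorphic_on ball 0 1"
      by (rule holomorphic_on_subset[OF g]) (use A ball_subset_cball[of 0 1] in blast)
  qed simp
  then have I: "((\<lambda>t. \<i> * g (cis t)) has_integral (2 * of_real pi * \<i> * g 0)) {0..2*pi}"
    unfolding circlepath_def
    by (subst (asm) has_contour_integral_part_circlepath_iff) (simp_all add: mult.commute)
  have ccis: "continuous_on {0..2*pi} (\<lambda>t. \<i> * g (cis t))"
    by (intro continuous_intros continuous_on_compose2[OF cont]) auto
  then have int: "set_integrable lborel {0..2*pi} (\<lambda>t. \<i> * g (cis t))"
    by (intro borel_integrable_atLeastAtMost') auto
  have "(LINT t:{0..2*pi}|lborel. \<i> * g (cis t)) = 2 * of_real pi * \<i> * g 0"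
    unfolding set_borel_integral_eq_integral(2)[OF int] by (rule integral_unique[OF I])
  then have "ennreal (2 * pi * norm (g 0)) = norm (LINT t:{0..2*pi}|lborel. \<i> * g (cis t))"
    by (simp add: norm_mult)
  also have "\<dots> \<le> (\<integral>\<^sup>+t. norm (indicator {0..2*pi} t *\<^sub>R (\<i> * g (cis t))) \<partial>lborel)"
    unfolding set_lebesgue_integral_def
    by (rule integral_norm_bound_ennreal) (use int in \<open>simp add: set_integrable_def\<close>)
  also have "\<dots> = (\<integral>\<^sup>+t\<in>{0..2*pi}. norm (g (cis t)) \<partial>lborel)"
    by (intro nn_integral_cong) (auto simp: norm_mult indicator_def)
  finally show ?thesis .
qed

text \<open>
  For fixed \<open>u\<close>, the value at the centre is at most the mean of \<open>|f|\<close> over the circle \<open>w + e^(it) u\<close>.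
  Integrate over \<open>u\<close> in the ball and exchange the integrals: by rotation invariance, the integral over
  \<open>u\<close> is the same for every \<open>t\<close>.
\<close>

lemma ball_mean_value_le:
  fixes f :: "complex^'n \<Rightarrow> complex"
  assumes f: "holomorphic_several_on f (ball w r)"
  shows "ennreal (norm (f w)) * emeasure lborel (ball (0::complex^'n) r)
    \<le> (\<integral>\<^sup>+u\<in>ball w r. norm (f u) \<partial>lborel)"
proof -
  \<comment> \<open>The integrand, moved to a ball about the origin so that rotations act on it.\<close>
  define F where "F u = ennreal (indicator (ball 0 r) u *\<^sub>R norm (f (w + u)))" for u
  have "(\<lambda>u. indicator (ball 0 r) u *\<^sub>R norm (f (w + u))) \<in> borel_measurable borel"
  proof (rule borel_measurable_continuous_on_indicator)
    show "continuous_on (ball 0 r) (\<lambda>u. norm (f (w + u)))"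
      by (intro continuous_intros continuous_on_compose2[OF holomorphic_several_on_continuous[OF f]])
         (auto simp: dist_norm)
  qed simp
  then have F[measurable]: "F \<in> borel_measurable borel" unfolding F_def by measurable
  have rot: "(\<integral>\<^sup>+u. F (cis t *s u) \<partial>lborel) = (\<integral>\<^sup>+u. F u \<partial>lborel)" for t
  proof -
    have m: "(\<lambda>u :: complex^'n. cis t *s u) \<in> borel_measurable lborel"
      using borel_measurable_continuous_onI[OF linear_continuous_on[OF bounded_linear_cvec_scale_right]]
      by simp
    have "(\<integral>\<^sup>+u. F u \<partial>lborel) = (\<integral>\<^sup>+u. F u \<partial>(distr lborel borel (\<lambda>u :: complex^'n. cis t *s u)))"
      by (simp add: distr_lborel_cvec_scale)
    also have "\<dots> = (\<integral>\<^sup>+u. F (cis t *s u) \<partial>lborel)"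
      by (rule nn_integral_distr[OF m]) simp
    finally show ?thesis by simp
  qed
  have trans: "(\<integral>\<^sup>+u\<in>ball w r. norm (f u) \<partial>lborel) = (\<integral>\<^sup>+u. F u \<partial>lborel)"
  proof -
    have "(\<lambda>u. ennreal (indicator (ball w r) u *\<^sub>R norm (f u))) \<in> borel_measurable borel"
      using borel_measurable_continuous_on_indicator[of "ball w r" "\<lambda>u. norm (f u)"]
        holomorphic_several_on_continuous[OF f] by (simp add: continuous_on_norm)
    then have "(\<integral>\<^sup>+u. ennreal (indicator (ball w r) u *\<^sub>R norm (f u)) \<partial>(distr lborel borel ((+) w)))
        = (\<integral>\<^sup>+u. ennreal (indicator (ball w r) (w + u) *\<^sub>R norm (f (w + u))) \<partial>lborel)"
      by (intro nn_integral_distr) auto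
    also have "\<dots> = (\<integral>\<^sup>+u. F u \<partial>lborel)"
      by (intro nn_integral_cong) (auto simp: F_def indicator_def dist_norm)
    finally have "(\<integral>\<^sup>+u. ennreal (indicator (ball w r) u *\<^sub>R norm (f u)) \<partial>lborel) = (\<integral>\<^sup>+u. F u \<partial>lborel)"
      by (simp only: lborel_distr_plus)
    moreover have "(\<integral>\<^sup>+u\<in>ball w r. norm (f u) \<partial>lborel)
        = (\<integral>\<^sup>+u. ennreal (indicator (ball w r) u *\<^sub>R norm (f u)) \<partial>lborel)"
      by (intro nn_integral_cong) (auto simp: indicator_def)
    ultimately show ?thesis by simp
  qed
  have pw: "ennreal (2 * pi * norm (f w)) * indicator (ball 0 r) u
      \<le> (\<integral>\<^sup>+t. indicator {0..2*pi} t * F (cis t *s u) \<partial>lborel)" for u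
  proof (cases "u \<in> ball 0 r")
    case True
    let ?A = "{t. w + t *s u \<in> ball w r}"
    have "ennreal (2 * pi * norm (f (w + 0 *s u))) \<le> (\<integral>\<^sup>+t\<in>{0..2*pi}. norm (f (w + cis t *s u)) \<partial>lborel)"
    proof (rule circle_mean_value_le)
      show "(\<lambda>t. f (w + t *s u)) holomorphic_on ?A"
        by (rule holomorphic_on_complex_line[OF f]) auto
      show "open ?A" by (intro open_complex_line_preimage) auto
      show "cball 0 1 \<subseteq> ?A"
      proof
        fix s :: complex assume "s \<in> cball 0 1"
        then have "norm s * norm u \<le> 1 * norm u" by (intro mult_right_mono) auto
        then show "s \<in> ?A" using True by (simp add: dist_norm norm_cvec_scale)
      qed
    qed
    also have "\<dots> = (\<integral>\<^sup>+t. indicator {0..2*pi} t * F (cis t *s u) \<partial>lborel)"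
      using True by (intro nn_integral_cong) (simp add: F_def norm_cvec_scale mult.commute)
    finally show ?thesis using True by simp
  qed simp
  have [measurable]: "(\<lambda>x :: real \<times> (complex^'n). cis (fst x) *s snd x) \<in> borel_measurable (borel \<Otimes>\<^sub>M borel)"
  proof -
    have "continuous_on UNIV (\<lambda>x :: real \<times> (complex^'n). \<chi> i. cis (fst x) * snd x $ i)"
      by (intro continuous_intros)
    then have "continuous_on UNIV (\<lambda>x :: real \<times> (complex^'n). cis (fst x) *s snd x)"
      by (simp add: vector_scalar_mult_def)
    then show ?thesis unfolding borel_prod by (rule borel_measurable_continuous_onI)
  qed
  have "ennreal (2 * pi) * (ennreal (norm (f w)) * emeasure lborel (ball (0::complex^'n) r))
      = (\<integral>\<^sup>+u. ennreal (2 * pi * norm (f w)) * indicator (ball (0::complex^'n) r) u \<partial>lborel)"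
    by (subst nn_integral_cmult_indicator) (simp_all add: ennreal_mult' mult.assoc)
  also have "\<dots> \<le> (\<integral>\<^sup>+u. \<integral>\<^sup>+t. indicator {0..2*pi} t * F (cis t *s u) \<partial>lborel \<partial>lborel)"
    by (intro nn_integral_mono pw)
  also have "\<dots> = (\<integral>\<^sup>+t. \<integral>\<^sup>+u. indicator {0..2*pi} t * F (cis t *s u) \<partial>lborel \<partial>lborel)"
  proof (rule lborel_pair.Fubini')
    have "(\<lambda>x :: real \<times> (complex^'n). indicator {0..2*pi} (fst x) * F (cis (fst x) *s snd x))
        \<in> borel_measurable (borel \<Otimes>\<^sub>M borel)"
      by measurable
    then show "(\<lambda>(t, u :: complex^'n). indicator {0..2*pi} t * F (cis t *s u))
        \<in> borel_measurable (lborel \<Otimes>\<^sub>M lborel)"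
      by (simp add: case_prod_beta cong: measurable_cong_sets sets_pair_measure_cong)
  qed
  also have "\<dots> = (\<integral>\<^sup>+t. indicator {0..2*pi} t * (\<integral>\<^sup>+u. F u \<partial>lborel) \<partial>lborel)"
  proof (rule nn_integral_cong)
    fix t :: real
    have [measurable]: "(\<lambda>u. F (cis t *s u)) \<in> borel_measurable borel"
      by (rule measurable_compose[OF borel_measurable_continuous_onI F])
         (intro linear_continuous_on bounded_linear_cvec_scale_right)
    show "(\<integral>\<^sup>+u. indicator {0..2*pi} t * F (cis t *s u) \<partial>lborel)
        = indicator {0..2*pi} t * (\<integral>\<^sup>+u. F u \<partial>lborel)"
      by (subst nn_integral_cmult) (simp_all add: rot)
  qed
  also have "\<dots> = ennreal (2 * pi) * (\<integral>\<^sup>+u. F u \<partial>lborel)"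
    by (subst nn_integral_multc) simp_all
  finally have "ennreal (2 * pi) * (ennreal (norm (f w)) * emeasure lborel (ball (0::complex^'n) r))
      \<le> ennreal (2 * pi) * (\<integral>\<^sup>+u. F u \<partial>lborel)" .
  then show ?thesis
    unfolding trans by (subst (asm) ennreal_mult_le_mult_iff) auto
qed

section \<open>Locally bounded families of holomorphic functions\<close>

text \<open>
  A diagonal argument gives convergence on a countable dense set, and equicontinuity extends it to
  \<open>\<Omega>\<close>.  Pointwise convergence is enough for the limit to be holomorphic: the second-order estimate is
  uniform in the sequence, so it makes the derivatives at each point converge and passes to the limit.
\<close>

theorem locally_bounded_convergent_subsequence:
  fixes F :: "nat \<Rightarrow> complex^'n \<Rightarrow> complex"
  assumes hol: "\<And>n. holomorphic_several_on (F n) \<Omega>"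
    and bdd: "\<And>w. w \<in> \<Omega> \<Longrightarrow>
      \<exists>r M. 0 < r \<and> ball w r \<subseteq> \<Omega> \<and> (\<forall>n. \<forall>x\<in>ball w r. norm (F n x) \<le> M)"
  obtains k g where "strict_mono k" "holomorphic_several_on g \<Omega>"
    "\<And>w. w \<in> \<Omega> \<Longrightarrow> (\<lambda>n. F (k n) w) \<longlonglongrightarrow> g w"
proof -
  obtain Q where Q: "countable Q" "Q \<subseteq> \<Omega>" "\<Omega> \<subseteq> closure Q"
    using separable by metis
  have "\<exists>B. \<forall>w\<in>\<Omega>. \<forall>n. norm (F n w) \<le> B w"
    by (intro bchoice ballI) (use bdd centre_in_ball in blast)
  then obtain B where B: "\<And>w n. w \<in> \<Omega> \<Longrightarrow> norm (F n w) \<le> B w" by blast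
  have B0: "0 \<le> B w" if "w \<in> \<Omega>" for w using B[OF that, of 0] norm_ge_zero order_trans by blast
  \<comment> \<open>Dividing by \<open>1 + B q\<close> makes the pointwise bounds uniform on \<open>Q\<close>, as the diagonal argument requires.\<close>
  obtain k where k: "strict_mono (k :: nat \<Rightarrow> nat)"
    and conv: "\<And>q. q \<in> Q \<Longrightarrow> \<exists>l. (\<lambda>n. F (k n) q / of_real (1 + B q)) \<longlonglongrightarrow> l"
  proof (rule function_convergent_subsequence[OF Q(1), of "\<lambda>n q. F n q / of_real (1 + B q)" 1])
    fix n q assume "q \<in> Q"
    then have q: "q \<in> \<Omega>" using Q(2) by blast
    have "norm (F n q / of_real (1 + B q)) = norm (F n q) / (1 + B q)"
      unfolding norm_divide norm_of_real using B0[OF q] by simp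
    also have "\<dots> \<le> 1" using B[OF q, of n] B0[OF q] by simp
    finally show "norm (F n q / of_real (1 + B q)) \<le> 1" .
  qed blast
  define G where "G n = F (k n)" for n
  have convQ: "Cauchy (\<lambda>n. G n q)" if q: "q \<in> Q" for q
  proof -
    obtain l where "(\<lambda>n. F (k n) q / of_real (1 + B q)) \<longlonglongrightarrow> l" using conv[OF q] by blast
    then have "(\<lambda>n. F (k n) q / of_real (1 + B q) * of_real (1 + B q)) \<longlonglongrightarrow> l * of_real (1 + B q)"
      by (intro tendsto_intros)
    moreover have "complex_of_real (1 + B q) \<noteq> 0"
      using B0[of q] q Q(2) by (metis of_real_eq_0_iff add_pos_nonneg less_irrefl subsetD zero_less_one)
    ultimately have "(\<lambda>n. G n q) \<longlonglongrightarrow> l * of_real (1 + B q)" by (simp add: G_def)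
    then show ?thesis by (rule LIMSEQ_imp_Cauchy)
  qed
  have holG: "holomorphic_several_on (G n) \<Omega>" for n using hol by (simp add: G_def)
  have local: "\<exists>r M. 0 < r \<and> 0 \<le> M \<and> ball w r \<subseteq> \<Omega> \<and> (\<forall>n. \<forall>x\<in>ball w r. norm (G n x) \<le> M)"
    if w: "w \<in> \<Omega>" for w
  proof -
    obtain r M where rM: "0 < r" "ball w r \<subseteq> \<Omega>" "\<forall>n. \<forall>x\<in>ball w r. norm (F n x) \<le> M"
      using bdd[OF w] by blast
    then have "norm (F 0 w) \<le> M" by simp
    then have "0 \<le> M" using norm_ge_zero order_trans by blast
    then show ?thesis using rM unfolding G_def by blast
  qed
  have "convergent (\<lambda>n. G n w)" if w: "w \<in> \<Omega>" for w
    unfolding Cauchy_convergent_iff[symmetric]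
  proof (rule metric_CauchyI)
    fix e :: real assume e: "0 < e"
    obtain r M where r: "0 < r" "0 \<le> M" "ball w r \<subseteq> \<Omega>" and M: "\<And>n x. x \<in> ball w r \<Longrightarrow> norm (G n x) \<le> M"
      using local[OF w] by blast
    define L where "L = 4 * M / r + 1"
    have L: "0 < L" using r by (auto simp: L_def intro: add_nonneg_pos)
    have "0 < min (r / 2) (e / (3 * L))" using r e L by simp
    moreover have "w \<in> closure Q" using w Q(3) by blast
    ultimately obtain q where q: "q \<in> Q" "dist q w < min (r / 2) (e / (3 * L))"
      unfolding closure_approachable by blast
    have close: "dist (G n q) (G n w) < e / 3" for n
    proof -
      have "norm (G n (w + (q - w)) - G n w) \<le> 4 * M / r * norm (q - w)"
        by (rule Cauchy_estimates_ball(1)[OF holomorphic_several_on_subset[OF holG r(3)] r(1) M])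
           (use q in \<open>auto simp: dist_norm\<close>)
      also have "\<dots> \<le> L * norm (q - w)" by (intro mult_right_mono) (auto simp: L_def)
      also have "\<dots> < e / 3" using q(2) L by (simp add: dist_norm field_simps)
      finally show ?thesis by (simp add: dist_norm)
    qed
    obtain N where N: "\<And>m n. m \<ge> N \<Longrightarrow> n \<ge> N \<Longrightarrow> dist (G m q) (G n q) < e / 3"
      using metric_CauchyD[OF convQ[OF q(1)], of "e / 3"] e by auto
    have "dist (G m w) (G n w) < e" if "m \<ge> N" "n \<ge> N" for m n
      using close[of m] close[of n] N[OF that] dist_triangle[of "G m w" "G n w" "G m q"]
        dist_triangle[of "G m q" "G n w" "G n q"] by (simp add: dist_commute)
    then show "\<exists>N. \<forall>m\<ge>N. \<forall>n\<ge>N. dist (G m w) (G n w) < e" by blast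
  qed
  then have "\<exists>l. (\<lambda>n. G n w) \<longlonglongrightarrow> l" if "w \<in> \<Omega>" for w
    using that unfolding convergent_def by blast
  then obtain g where g: "\<And>w. w \<in> \<Omega> \<Longrightarrow> (\<lambda>n. G n w) \<longlonglongrightarrow> g w" by metis
  have "holomorphic_several_on g \<Omega>"
    unfolding holomorphic_several_on_def
  proof
    fix w assume w: "w \<in> \<Omega>"
    obtain r M where r: "0 < r" "0 \<le> M" "ball w r \<subseteq> \<Omega>" and M: "\<And>n x. x \<in> ball w r \<Longrightarrow> norm (G n x) \<le> M"
      using local[OF w] by blast
    define C where "C = 32 * M / r^2"
    have C: "0 \<le> C" using r by (simp add: C_def)
    have "\<exists>D. \<forall>n. (G n has_derivative D n) (at w) \<and> (\<forall>c v. D n (c *s v) = c * D n v)"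
      by (intro choice allI) (use holG w in \<open>auto simp: holomorphic_several_on_def\<close>)
    then obtain D where D: "\<And>n. (G n has_derivative D n) (at w)"
      and D_scale: "\<And>n c v. D n (c *s v) = c * D n v" by blast
    have est: "norm (G n (w + h) - G n w - D n h) \<le> C * norm h ^ 2" if "norm h \<le> r / 2" for n h
      unfolding C_def
      by (rule Cauchy_estimates_ball(2)[OF holomorphic_several_on_subset[OF holG r(3)] r(1) M that D D_scale])
    have in_ball: "w + h \<in> \<Omega>" if "norm h \<le> r / 2" for h
      using that r by (intro subsetD[OF r(3)]) (simp add: dist_norm)
    have "convergent (\<lambda>n. D n h)" for h
      unfolding Cauchy_convergent_iff[symmetric]
    proof (rule metric_CauchyI)
      fix e :: real assume e: "0 < e"
      \<comment> \<open>A step so short that each difference quotient with step \<open>t\<close> is within \<open>e/4\<close> of the derivative.\<close>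
      define t where "t = min (r / (2 * (norm h + 1))) (e / (4 * (C * norm h ^ 2 + 1)))"
      have pos: "0 < norm h + 1" "0 < C * norm h ^ 2 + 1"
        using C by (auto intro: add_nonneg_pos)
      have t: "0 < t" "t \<le> r / (2 * (norm h + 1))" "t \<le> e / (4 * (C * norm h ^ 2 + 1))"
        using pos r e by (auto simp: t_def)
      have "t * (norm h + 1) \<le> r / 2" using t(2) pos by (simp add: field_simps)
      then have nth: "norm (complex_of_real t *s h) \<le> r / 2"
        using t(1) by (simp add: norm_cvec_scale algebra_simps)
      have "t * (C * norm h ^ 2 + 1) \<le> e / 4" using t(3) pos by (simp add: field_simps)
      then have Ct: "C * (t * norm h ^ 2) \<le> e / 4"
        using t(1) by (simp add: algebra_simps)
      let ?H = "\<lambda>n. G n (w + of_real t *s h) - G n w"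
      have lim: "?H \<longlonglongrightarrow> g (w + of_real t *s h) - g w"
        by (intro tendsto_diff g w in_ball nth)
      have "0 < t * e / 2" using t e by simp
      from metric_CauchyD[OF LIMSEQ_imp_Cauchy[OF lim] this]
      obtain N where N: "\<And>m n. m \<ge> N \<Longrightarrow> n \<ge> N \<Longrightarrow> dist (?H m) (?H n) < t * e / 2"
        by blast
      have close: "norm (?H n - of_real t * D n h) \<le> t * (e / 4)" for n
      proof -
        have "norm (?H n - of_real t * D n h) \<le> C * (t * norm h) ^ 2"
          using est[OF nth, of n] t(1) by (simp add: D_scale norm_cvec_scale)
        also have "\<dots> = t * (C * (t * norm h ^ 2))" by (simp add: power2_eq_square)
        also have "\<dots> \<le> t * (e / 4)" using Ct t by (intro mult_left_mono) auto
        finally show ?thesis .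
      qed
      have "dist (D m h) (D n h) < e" if "m \<ge> N" "n \<ge> N" for m n
      proof -
        have "t * dist (D m h) (D n h) = norm (of_real t * D m h - of_real t * D n h)"
          using t(1) by (simp add: dist_norm norm_mult flip: right_diff_distrib)
        also have "\<dots> = norm ((?H m - ?H n) - (?H m - of_real t * D m h) + (?H n - of_real t * D n h))"
          by (simp add: algebra_simps)
        also have "\<dots> \<le> norm (?H m - ?H n) + norm (?H m - of_real t * D m h) + norm (?H n - of_real t * D n h)"
          using norm_triangle_ineq[of "(?H m - ?H n) - (?H m - of_real t * D m h)" "?H n - of_real t * D n h"]
            norm_triangle_ineq4[of "?H m - ?H n" "?H m - of_real t * D m h"] by linarith
        also have "\<dots> < t * e / 2 + t * (e / 4) + t * (e / 4)"
          using N[OF that, unfolded dist_norm] close[of m] close[of n] by linarith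
        finally show ?thesis using t(1) by (simp add: field_simps)
      qed
      then show "\<exists>N. \<forall>m\<ge>N. \<forall>n\<ge>N. dist (D m h) (D n h) < e" by blast
    qed
    then have "\<exists>l. (\<lambda>n. D n h) \<longlonglongrightarrow> l" for h unfolding convergent_def by blast
    then obtain D' where D': "\<And>h. (\<lambda>n. D n h) \<longlonglongrightarrow> D' h" by metis
    have D'_scale: "D' (c *s v) = c * D' v" for c v
      using LIMSEQ_unique[OF D'[of "c *s v"]] tendsto_mult[OF tendsto_const[of c] D'[of v]]
      by (simp add: D_scale)
    have D'_add: "D' (u + v) = D' u + D' v" for u v
    proof -
      have "D n (u + v) = D n u + D n v" for n
        using D[of n] by (simp add: has_derivative_def bounded_linear.linear linear_add)
      then show ?thesis
        using LIMSEQ_unique[OF D'[of "u + v"]] tendsto_add[OF D'[of u] D'[of v]] by simp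
    qed
    have "linear D'"
      by (rule linearI) (simp_all add: D'_add D'_scale scaleR_eq_cvec_scale scaleR_conv_of_real)
    then have bl: "bounded_linear D'" by (simp add: linear_conv_bounded_linear)
    have lim_est: "norm (g (w + h) - g w - D' h) \<le> C * norm h ^ 2" if "norm h \<le> r / 2" for h
    proof (rule LIMSEQ_le_const2)
      show "(\<lambda>n. norm (G n (w + h) - G n w - D n h)) \<longlonglongrightarrow> norm (g (w + h) - g w - D' h)"
        by (intro tendsto_intros g w in_ball that D')
    qed (use est[OF that] in blast)
    have "(g has_derivative D') (at w)"
    proof (rule has_derivativeI_sandwich[where e = "r / 2" and H = "\<lambda>y. C * norm (y - w)"])
      show "((\<lambda>y. C * norm (y - w)) \<longlongrightarrow> 0) (at w)"
        by (rule tendsto_eq_intros refl tendsto_ident_at | simp)+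
      fix y assume y: "y \<noteq> w" "dist y w < r / 2"
      then have "norm (g (w + (y - w)) - g w - D' (y - w)) \<le> C * norm (y - w) ^ 2"
        by (intro lim_est) (simp add: dist_norm)
      then show "norm (g y - g w - D' (y - w)) / norm (y - w) \<le> C * norm (y - w)"
        using y by (simp add: divide_le_eq power2_eq_square mult.assoc)
    qed (use r bl in auto)
    then show "\<exists>D. (g has_derivative D) (at w) \<and> (\<forall>c v. D (c *s v) = c * D v)"
      using D'_scale by blast
  qed
  with k show ?thesis by (rule that) (use g in \<open>simp add: G_def\<close>)
qed

section \<open>Existence of a minimizer\<close>

lemma set_borel_measurable_lebesgue_continuous:
  fixes g :: "'a::euclidean_space \<Rightarrow> 'b::real_normed_vector"
  assumes "open A" "continuous_on A g"
  shows "(\<lambda>x. indicator A x *\<^sub>R g x) \<in> borel_measurable lebesgue"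
proof -
  have "(\<lambda>x. indicator A x *\<^sub>R g x) \<in> borel_measurable borel"
    by (rule borel_measurable_continuous_on_indicator) (use assms in auto)
  then show ?thesis by (intro measurable_completion) simp
qed

lemma continuous_on_norm_powr:
  assumes "continuous_on A f" "0 < p"
  shows "continuous_on A (\<lambda>w. norm (f w) powr p)"
  using assms by (intro continuous_on_powr') (auto intro!: continuous_intros)

lemma bergman_space_holomorphic: "f \<in> bergman_space p \<Omega> \<Longrightarrow> holomorphic_several_on f \<Omega>"
  and bergman_space_integrable:
    "f \<in> bergman_space p \<Omega> \<Longrightarrow> set_integrable lebesgue \<Omega> (\<lambda>w. norm (f w) powr p)"
  by (auto simp: bergman_space_def)

lemma bergman_norm_powr:
  assumes "p \<noteq> 0"
  shows "bergman_norm p \<Omega> f powr p = (LINT w:\<Omega>|lebesgue. norm (f w) powr p)"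
proof -
  have "0 \<le> (LINT w:\<Omega>|lebesgue. norm (f w) powr p)"
    unfolding set_lebesgue_integral_def by (intro integral_nonneg_AE) auto
  then show ?thesis using assms by (simp add: bergman_norm_def powr_powr)
qed

lemma bergman_norm_nonneg: "0 \<le> bergman_norm p \<Omega> f"
  by (simp add: bergman_norm_def)

lemma nn_integral_bergman:
  assumes "f \<in> bergman_space p \<Omega>" "p \<noteq> 0"
  shows "(\<integral>\<^sup>+w. ennreal (indicator \<Omega> w *\<^sub>R norm (f w) powr p) \<partial>lebesgue) = ennreal (bergman_norm p \<Omega> f powr p)"
  unfolding bergman_norm_powr[OF assms(2)] set_lebesgue_integral_def
  by (rule nn_integral_eq_integral)
     (use bergman_space_integrable[OF assms(1)] in \<open>auto simp: set_integrable_def\<close>)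

text \<open>
  The mean value inequality for \<open>|f|\<close>, combined with the crude \<open>|f| \<le> 1 + |f|^p\<close>; what matters is only
  that the bound depends on \<open>f\<close> through its norm.
\<close>

lemma bergman_pointwise_bound:
  fixes f :: "complex^'n \<Rightarrow> complex"
  assumes p: "1 \<le> p" and f: "f \<in> bergman_space p \<Omega>" and \<Omega>: "open \<Omega>" and r: "0 < r" "ball w r \<subseteq> \<Omega>"
  shows "norm (f w) \<le> 1 + bergman_norm p \<Omega> f powr p / measure lborel (ball (0 :: complex^'n) r)"
proof -
  let ?V = "measure lborel (ball (0 :: complex^'n) r)"
  let ?N = "bergman_norm p \<Omega> f powr p"
  have V: "0 < ?V" using r by simp
  have eV: "emeasure lborel (ball c r) = ennreal ?V" for c :: "complex^'n"
    using r by (simp add: emeasure_ball content_ball)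
  have le: "norm (f u) \<le> 1 + norm (f u) powr p" for u
  proof (cases "norm (f u) \<le> 1")
    case False
    then have "norm (f u) powr 1 \<le> norm (f u) powr p" using p by (intro powr_mono) auto
    then show ?thesis using False by simp
  qed (simp add: add_increasing2)
  have mb: "(\<lambda>u. indicator \<Omega> u *\<^sub>R norm (f u) powr p) \<in> borel_measurable lborel"
    using borel_measurable_continuous_on_indicator[of \<Omega> "\<lambda>u. norm (f u) powr p"] \<Omega> p
      continuous_on_norm_powr[OF holomorphic_several_on_continuous[OF bergman_space_holomorphic[OF f]], of p]
    by simp
  have "ennreal (norm (f w) * ?V) = ennreal (norm (f w)) * emeasure lborel (ball (0::complex^'n) r)"
    by (simp add: eV ennreal_mult')
  also have "\<dots> \<le> (\<integral>\<^sup>+u\<in>ball w r. norm (f u) \<partial>lborel)"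
    by (intro ball_mean_value_le holomorphic_several_on_subset[OF bergman_space_holomorphic[OF f] r(2)])
  also have "\<dots> \<le> (\<integral>\<^sup>+u. indicator (ball w r) u + ennreal (indicator \<Omega> u *\<^sub>R norm (f u) powr p) \<partial>lborel)"
  proof (rule nn_integral_mono)
    fix u
    have "ennreal (norm (f u)) \<le> 1 + ennreal (norm (f u) powr p)"
      using ennreal_leI[OF le[of u]] by (simp add: ennreal_plus)
    then show "ennreal (norm (f u)) * indicator (ball w r) u
        \<le> indicator (ball w r) u + ennreal (indicator \<Omega> u *\<^sub>R norm (f u) powr p)"
      using r(2) by (auto simp: indicator_def)
  qed
  also have "\<dots> = emeasure lborel (ball w r) + (\<integral>\<^sup>+u. ennreal (indicator \<Omega> u *\<^sub>R norm (f u) powr p) \<partial>lborel)"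
    by (subst nn_integral_add[OF _ measurable_compose[OF mb measurable_ennreal]])
       (simp_all add: borel_measurable_indicator)
  also have "\<dots> = ennreal (?V + ?N)"
    using nn_integral_bergman[OF f] p by (simp add: nn_integral_completion eV ennreal_plus)
  finally have "norm (f w) * ?V \<le> ?V + ?N"
    by (subst (asm) ennreal_le_iff) (auto intro: add_nonneg_nonneg)
  then show ?thesis using V by (simp add: field_simps)
qed

lemma const_in_bergman_space:
  assumes "open \<Omega>" "bounded \<Omega>"
  shows "(\<lambda>_. c) \<in> bergman_space p \<Omega>"
  using assms lmeasurable_open[of \<Omega>]
  by (simp add: bergman_space_def holomorphic_several_on_const set_integrable_def fmeasurable_def)

lemma min_norm_le:
  assumes "f \<in> bergman_space p \<Omega>" "f z = 1"
  shows "min_norm p \<Omega> z \<le> bergman_norm p \<Omega> f"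
  unfolding min_norm_def using assms
  by (intro cInf_lower bdd_belowI[of _ 0]) (auto simp: bergman_norm_nonneg)

lemma min_norm_nonneg:
  assumes "open \<Omega>" "bounded \<Omega>"
  shows "0 \<le> min_norm p \<Omega> z"
  unfolding min_norm_def using const_in_bergman_space[OF assms, of 1 p]
  by (intro cInf_greatest) (auto simp: bergman_norm_nonneg)

text \<open>
  A minimizing sequence is locally uniformly bounded, so a subsequence converges to a holomorphic
  function, whose norm is at most the infimum by Fatou's lemma.
\<close>

theorem bergman_minimizer_exists:
  fixes \<Omega> :: "(complex^'n) set"
  assumes \<Omega>: "open \<Omega>" "bounded \<Omega>" and p: "1 \<le> p" and z: "z \<in> \<Omega>"
  obtains m where "m \<in> bergman_space p \<Omega>" "m z = 1" "bergman_norm p \<Omega> m = min_norm p \<Omega> z"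
proof -
  let ?X = "{bergman_norm p \<Omega> f |f. f \<in> bergman_space p \<Omega> \<and> f z = 1}"
  let ?\<mu> = "min_norm p \<Omega> z"
  have p0: "p \<noteq> 0" "0 < p" using p by auto
  have "\<exists>f. f \<in> bergman_space p \<Omega> \<and> f z = 1 \<and> bergman_norm p \<Omega> f < ?\<mu> + 1 / real (Suc n)" for n
  proof -
    have "?X \<noteq> {}" using const_in_bergman_space[OF \<Omega>, of 1 p] by blast
    moreover have "Inf ?X < ?\<mu> + 1 / real (Suc n)" by (simp add: min_norm_def)
    ultimately have "\<exists>x\<in>?X. x < ?\<mu> + 1 / real (Suc n)" by (rule cInf_lessD)
    then show ?thesis by blast
  qed
  then obtain F where F: "\<And>n. F n \<in> bergman_space p \<Omega>" "\<And>n. F n z = 1"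
    and lt: "\<And>n. bergman_norm p \<Omega> (F n) < ?\<mu> + 1 / real (Suc n)" by metis
  have \<mu>0: "0 \<le> ?\<mu>" by (rule min_norm_nonneg[OF \<Omega>])
  have lim: "(\<lambda>n. bergman_norm p \<Omega> (F n)) \<longlonglongrightarrow> ?\<mu>"
  proof (rule tendsto_sandwich[where f = "\<lambda>_. ?\<mu>" and h = "\<lambda>n. ?\<mu> + 1 / real (Suc n)"])
    show "(\<lambda>n. ?\<mu> + 1 / real (Suc n)) \<longlonglongrightarrow> ?\<mu>"
      using tendsto_add[OF tendsto_const[of ?\<mu>] LIMSEQ_inverse_real_of_nat]
      by (simp add: inverse_eq_divide)
  qed (use min_norm_le[OF F] lt in \<open>auto intro!: always_eventually less_imp_le\<close>)
  have bound: "bergman_norm p \<Omega> (F n) powr p \<le> (?\<mu> + 1) powr p" for n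
  proof (rule powr_mono2)
    show "bergman_norm p \<Omega> (F n) \<le> ?\<mu> + 1"
      using lt[of n] by (rule less_imp_le[OF less_le_trans]) simp
  qed (use p bergman_norm_nonneg in auto)
  have bdd: "\<exists>r M. 0 < r \<and> ball w r \<subseteq> \<Omega> \<and> (\<forall>n. \<forall>x\<in>ball w r. norm (F n x) \<le> M)"
    if w: "w \<in> \<Omega>" for w
  proof -
    obtain e where e: "0 < e" "ball w e \<subseteq> \<Omega>" using \<Omega>(1) w by (auto simp: open_contains_ball)
    let ?V = "measure lborel (ball (0 :: complex^'n) (e/2))"
    have "norm (F n x) \<le> 1 + (?\<mu> + 1) powr p / ?V" if x: "x \<in> ball w (e/2)" for n x
    proof -
      have "ball x (e/2) \<subseteq> \<Omega>"
      proof
        fix y assume "y \<in> ball x (e/2)"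
        then have "dist w y < e" using x dist_triangle[of w y x] by simp
        then show "y \<in> \<Omega>" using e by auto
      qed
      then have "norm (F n x) \<le> 1 + bergman_norm p \<Omega> (F n) powr p / ?V"
        by (intro bergman_pointwise_bound[OF p F(1) \<Omega>(1)]) (use e in auto)
      also have "\<dots> \<le> 1 + (?\<mu> + 1) powr p / ?V"
        by (intro add_left_mono divide_right_mono bound) simp
      finally show ?thesis .
    qed
    then show ?thesis using e by (intro exI[of _ "e/2"] exI) auto
  qed
  obtain k g where k: "strict_mono k" and g: "holomorphic_several_on g \<Omega>"
    and conv: "\<And>w. w \<in> \<Omega> \<Longrightarrow> (\<lambda>n. F (k n) w) \<longlonglongrightarrow> g w"
    using locally_bounded_convergent_subsequence[of F \<Omega>, OF bergman_space_holomorphic[OF F(1)] bdd] by blast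
  let ?u = "\<lambda>f w. ennreal (indicator \<Omega> w *\<^sub>R norm (f w) powr p)"
  have meas: "(\<lambda>w. indicator \<Omega> w *\<^sub>R norm (f w) powr p) \<in> borel_measurable lebesgue"
    if "holomorphic_several_on f \<Omega>" for f
    using that p by (intro set_borel_measurable_lebesgue_continuous \<Omega> continuous_on_norm_powr
        holomorphic_several_on_continuous) auto
  have "(\<integral>\<^sup>+w. ?u g w \<partial>lebesgue) = (\<integral>\<^sup>+w. liminf (\<lambda>n. ?u (F (k n)) w) \<partial>lebesgue)"
  proof (rule nn_integral_cong)
    fix w
    have "(\<lambda>n. ?u (F (k n)) w) \<longlonglongrightarrow> ?u g w"
    proof (cases "w \<in> \<Omega>")
      case True
      then have "(\<lambda>n. norm (F (k n) w) powr p) \<longlonglongrightarrow> norm (g w) powr p"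
        using p by (intro tendsto_powr' tendsto_norm conv tendsto_const) auto
      then show ?thesis using True by (simp add: tendsto_ennrealI)
    qed simp
    from lim_imp_Liminf[OF _ this] show "?u g w = liminf (\<lambda>n. ?u (F (k n)) w)"
      by (simp only: sequentially_bot not_False_eq_True simp_thms)
  qed
  also have "\<dots> \<le> liminf (\<lambda>n. \<integral>\<^sup>+w. ?u (F (k n)) w \<partial>lebesgue)"
    by (rule nn_integral_liminf) (use meas bergman_space_holomorphic[OF F(1)] in auto)
  also have "\<dots> = liminf (\<lambda>n. ennreal (bergman_norm p \<Omega> (F (k n)) powr p))"
    by (simp only: nn_integral_bergman[OF F(1) p0(1)])
  also have "\<dots> = ennreal (?\<mu> powr p)"
  proof (rule lim_imp_Liminf)
    have "(\<lambda>n. bergman_norm p \<Omega> (F (k n))) \<longlonglongrightarrow> ?\<mu>"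
      using LIMSEQ_subseq_LIMSEQ[OF lim k] by (simp add: o_def)
    then show "(\<lambda>n. ennreal (bergman_norm p \<Omega> (F (k n)) powr p)) \<longlonglongrightarrow> ennreal (?\<mu> powr p)"
      using p bergman_norm_nonneg by (intro tendsto_ennrealI tendsto_powr' tendsto_const) (auto intro!: always_eventually)
  qed simp
  finally have fatou: "(\<integral>\<^sup>+w. ?u g w \<partial>lebesgue) \<le> ennreal (?\<mu> powr p)" .
  have gA: "g \<in> bergman_space p \<Omega>"
    unfolding bergman_space_def set_integrable_def
  proof (safe intro!: g integrableI_bounded meas)
    have "(\<integral>\<^sup>+w. ennreal (norm (indicator \<Omega> w *\<^sub>R norm (g w) powr p)) \<partial>lebesgue) = (\<integral>\<^sup>+w. ?u g w \<partial>lebesgue)"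
      by (intro nn_integral_cong) (simp add: abs_mult)
    then show "(\<integral>\<^sup>+w. ennreal (norm (indicator \<Omega> w *\<^sub>R norm (g w) powr p)) \<partial>lebesgue) < \<infinity>"
      using fatou ennreal_less_top le_less_trans by (metis infinity_ennreal_def)
  qed
  have gz: "g z = 1" using LIMSEQ_unique[OF conv[OF z]] F(2) by simp
  have "bergman_norm p \<Omega> g powr p \<le> ?\<mu> powr p"
    using fatou nn_integral_bergman[OF gA p0(1)] by simp
  then have "bergman_norm p \<Omega> g \<le> ?\<mu>"
    using p0 \<mu>0 bergman_norm_nonneg[of p \<Omega> g] powr_less_mono2[of p ?\<mu> "bergman_norm p \<Omega> g"]
    by (meson not_le)
  with min_norm_le[of g, OF gA gz] have "bergman_norm p \<Omega> g = ?\<mu>" by simp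
  with gA gz show ?thesis by (rule that)
qed

section \<open>Convexity of the p-th power of the modulus\<close>

lemma norm_powr_convex:
  fixes a b :: complex
  assumes p: "1 \<le> p" and uv: "0 \<le> u" "0 \<le> v" "u + v = (1::real)"
  shows "norm (u *\<^sub>R a + v *\<^sub>R b) powr p \<le> u * norm a powr p + v * norm b powr p"
proof -
  have scale: "(t * x) powr p \<le> t * x powr p" if "0 \<le> t" "t \<le> 1" "0 \<le> x" for t x :: real
  proof -
    have "t powr p \<le> t powr 1" using that p by (intro powr_mono') auto
    then show ?thesis using that by (simp add: powr_mult mult_right_mono)
  qed
  have conv: "(u * x + v * y) powr p \<le> u * x powr p + v * y powr p" if "0 \<le> x" "0 \<le> y" for x y
  proof -
    consider "x = 0" | "y = 0" | "0 < x" "0 < y" using \<open>0 \<le> x\<close> \<open>0 \<le> y\<close> by linarith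
    then show ?thesis
    proof cases
      case 1 then show ?thesis using scale[of v y] uv that by simp
    next
      case 2 then show ?thesis using scale[of u x] uv that by simp
    next
      case 3
      then show ?thesis
        using convex_onD[OF powr_convex[OF p], of v x y] uv by (simp add: eq_diff_eq[symmetric])
    qed
  qed
  have "norm (u *\<^sub>R a + v *\<^sub>R b) powr p \<le> (u * norm a + v * norm b) powr p"
    using p uv by (intro powr_mono2 norm_triangle_le) auto
  also have "\<dots> \<le> u * norm a powr p + v * norm b powr p" by (intro conv) auto
  finally show ?thesis .
qed

lemma norm_add_powr_le:
  fixes a b :: complex
  assumes "1 \<le> p"
  shows "norm (a + b) powr p \<le> 2 powr p * (norm a powr p + norm b powr p)"
proof -
  have "norm ((1/2) *\<^sub>R (2 *\<^sub>R a) + (1/2) *\<^sub>R (2 *\<^sub>R b)) powr p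
      \<le> 1/2 * norm (2 *\<^sub>R a) powr p + 1/2 * norm (2 *\<^sub>R b) powr p"
    by (rule norm_powr_convex[OF assms]) auto
  also have "\<dots> = 2 powr p * (norm a powr p + norm b powr p) / 2"
    by (simp add: powr_mult algebra_simps)
  also have "\<dots> \<le> 2 powr p * (norm a powr p + norm b powr p)" by simp
  finally show ?thesis by simp
qed

text \<open>
  Monotonicity of the difference quotients of the convex function \<open>t \<mapsto> |a + t b|^p\<close>: the quotient on
  \<open>[0, t]\<close> lies between those on \<open>[-1, 0]\<close> and \<open>[0, 1]\<close>.
\<close>

lemma norm_powr_difference_quotient:
  fixes a b :: complex
  assumes p: "1 \<le> p" and t: "0 < t" "t \<le> 1"
  shows "(norm (a + t *\<^sub>R b) powr p - norm a powr p) / t \<le> norm (a + b) powr p - norm a powr p"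
    and "norm a powr p - norm (a - b) powr p \<le> (norm (a + t *\<^sub>R b) powr p - norm a powr p) / t"
proof -
  have "norm ((1 - t) *\<^sub>R a + t *\<^sub>R (a + b)) powr p \<le> (1 - t) * norm a powr p + t * norm (a + b) powr p"
    by (rule norm_powr_convex[OF p]) (use t in auto)
  moreover have "(1 - t) *\<^sub>R a + t *\<^sub>R (a + b) = a + t *\<^sub>R b" by (simp add: algebra_simps)
  ultimately show "(norm (a + t *\<^sub>R b) powr p - norm a powr p) / t \<le> norm (a + b) powr p - norm a powr p"
    using t by (simp add: field_simps)
  \<comment> \<open>Here \<open>a\<close> is the convex combination of \<open>a + t b\<close> and \<open>a - b\<close> with weights \<open>1/(1+t)\<close> and \<open>t/(1+t)\<close>.\<close>
  have "norm ((1 / (1 + t)) *\<^sub>R (a + t *\<^sub>R b) + (t / (1 + t)) *\<^sub>R (a - b)) powr p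
      \<le> 1 / (1 + t) * norm (a + t *\<^sub>R b) powr p + t / (1 + t) * norm (a - b) powr p"
    by (rule norm_powr_convex[OF p]) (use t in \<open>auto simp: field_simps\<close>)
  moreover have "(1 / (1 + t)) *\<^sub>R (a + t *\<^sub>R b) + (t / (1 + t)) *\<^sub>R (a - b) = a"
  proof -
    have "(1 / (1 + t)) *\<^sub>R (a + t *\<^sub>R b) + (t / (1 + t)) *\<^sub>R (a - b)
        = (1 / (1 + t)) *\<^sub>R ((1 + t) *\<^sub>R a)"
      by (simp add: scaleR_right_distrib scaleR_left_distrib scaleR_right_diff_distrib)
    then show ?thesis using t by simp
  qed
  ultimately have "norm a powr p \<le> (norm (a + t *\<^sub>R b) powr p + t * norm (a - b) powr p) / (1 + t)"
    by (simp add: add_divide_distrib)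
  then show "norm a powr p - norm (a - b) powr p \<le> (norm (a + t *\<^sub>R b) powr p - norm a powr p) / t"
    using t by (simp add: field_simps)
qed

text \<open>
  Written as the power \<open>p/2\<close> of \<open>|a + t b|^2\<close>, a quadratic polynomial in \<open>t\<close> that is positive at 0.
\<close>

lemma DERIV_norm_powr_line:
  fixes a b :: complex
  assumes a: "a \<noteq> 0"
  shows "((\<lambda>t. norm (a + t *\<^sub>R b) powr p) has_real_derivative
      p * (norm a powr (p - 2) * Re (cnj a * b))) (at 0)"
proof -
  have eq: "norm (a + t *\<^sub>R b) powr p
      = (norm a ^ 2 + 2 * t * Re (cnj a * b) + t^2 * norm b ^ 2) powr (p / 2)" for t :: real
  proof -
    have "norm (a + t *\<^sub>R b) ^ 2 = norm a ^ 2 + 2 * t * Re (cnj a * b) + t^2 * norm b ^ 2"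
      unfolding cmod_power2 by (simp add: algebra_simps power2_eq_square)
    moreover have "norm (a + t *\<^sub>R b) powr p = (norm (a + t *\<^sub>R b) ^ 2) powr (p / 2)"
      by (cases "a + t *\<^sub>R b = 0") (simp_all add: powr_powr flip: powr_numeral)
    ultimately show ?thesis by simp
  qed
  have pos: "0 < norm a ^ 2" using a by simp
  have "norm a powr (p - 2) = (norm a ^ 2) powr (p / 2 - 1)"
  proof -
    have "(norm a ^ 2) powr (p / 2 - 1) = (norm a powr 2) powr (p / 2 - 1)" by simp
    also have "\<dots> = norm a powr (p - 2)" unfolding powr_powr by (simp add: algebra_simps)
    finally show ?thesis by simp
  qed
  then show ?thesis
    unfolding eq using pos by (auto intro!: derivative_eq_intros)
qed

text \<open>
  This is \<open>|a|^(p-1) |b| \<le> max(|a|, |b|)^p\<close>.  When \<open>p < 2\<close> and \<open>a = 0\<close>, the left-hand side vanishes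
  because \<open>0 powr (p - 2) = 0\<close>.
\<close>

lemma norm_powr_weight_le:
  fixes a b :: complex
  assumes p: "1 \<le> p"
  shows "norm (of_real (norm a powr (p - 2)) * cnj a * b) \<le> norm a powr p + norm b powr p"
proof (cases "a = 0 \<or> b = 0")
  case False
  define M where "M = max (norm a) (norm b)"
  have M: "0 < M" "norm a \<le> M" "norm b \<le> M" using False by (auto simp: M_def less_max_iff_disj)
  have "norm (of_real (norm a powr (p - 2)) * cnj a * b) = norm a * norm a powr (p - 2) * norm b"
    by (simp add: norm_mult)
  also have "\<dots> = norm a powr (p - 1) * norm b" by (simp add: powr_mult_base)
  also have "\<dots> \<le> M powr (p - 1) * M" using M p by (intro mult_mono powr_mono2) auto
  also have "\<dots> = M powr p" using M by (simp add: mult.commute powr_mult_base)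
  also have "\<dots> \<le> norm a powr p + norm b powr p" by (simp add: M_def max_def)
  finally show ?thesis .
qed auto

lemma norm_powr_weight_self:
  fixes a :: complex
  shows "of_real (norm a powr (p - 2)) * cnj a * a = of_real (norm a powr p)"
proof (cases "a = 0")
  case False
  have "cnj a * a = of_real ((norm a)\<^sup>2)" by (simp only: complex_norm_square mult.commute)
  moreover have "norm a powr p = norm a powr (p - 2) * (norm a)\<^sup>2"
    using powr_add[of "norm a" "p - 2" 2] by simp
  ultimately show ?thesis by (simp add: mult.assoc)
qed simp

section \<open>The Bergman space is a vector space\<close>

lemma bergman_space_add:
  fixes f g :: "complex^'n \<Rightarrow> complex"
  assumes p: "1 \<le> p" and \<Omega>: "open \<Omega>" and f: "f \<in> bergman_space p \<Omega>" and g: "g \<in> bergman_space p \<Omega>"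
  shows "(\<lambda>w. f w + g w) \<in> bergman_space p \<Omega>"
proof -
  have hol: "holomorphic_several_on (\<lambda>w. f w + g w) \<Omega>"
    using f g by (intro holomorphic_several_on_add bergman_space_holomorphic)
  have "set_integrable lebesgue \<Omega> (\<lambda>w. 2 powr p * (norm (f w) powr p + norm (g w) powr p))"
    using f g by (intro set_integrable_mult_right set_integral_add(1) bergman_space_integrable)
  then have "set_integrable lebesgue \<Omega> (\<lambda>w. norm (f w + g w) powr p)"
  proof (rule set_integrable_bound)
    show "set_borel_measurable lebesgue \<Omega> (\<lambda>w. norm (f w + g w) powr p)"
      unfolding set_borel_measurable_def
      using hol p \<Omega> by (intro set_borel_measurable_lebesgue_continuous continuous_on_norm_powr
          holomorphic_several_on_continuous) auto
  qed (use norm_add_powr_le[OF p] in \<open>auto intro!: AE_I2\<close>)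
  with hol show ?thesis by (simp add: bergman_space_def)
qed

lemma bergman_space_cmult:
  assumes "f \<in> bergman_space p \<Omega>"
  shows "(\<lambda>w. c * f w) \<in> bergman_space p \<Omega>"
  using assms by (simp add: bergman_space_def holomorphic_several_on_cmult norm_mult powr_mult)

text \<open>
  The integrand is dominated by \<open>|m|^p + |f|^p\<close>.  Its measurability is checked on the functions extended
  by 0 off \<open>\<Omega>\<close>, because for \<open>p \<le> 2\<close> the factor \<open>|m|^(p-2)\<close> is not continuous at zeros of \<open>m\<close>.
\<close>

lemma set_integrable_norm_powr_weight:
  fixes f m :: "complex^'n \<Rightarrow> complex"
  assumes p: "1 \<le> p" and \<Omega>: "open \<Omega>" and m: "m \<in> bergman_space p \<Omega>" and f: "f \<in> bergman_space p \<Omega>"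
  shows "set_integrable lebesgue \<Omega> (\<lambda>w. of_real (norm (m w) powr (p - 2)) * cnj (m w) * f w)"
proof -
  have "set_integrable lebesgue \<Omega> (\<lambda>w. norm (m w) powr p + norm (f w) powr p)"
    using f m by (intro set_integral_add(1) bergman_space_integrable)
  then show ?thesis
  proof (rule set_integrable_bound)
    define X where "X w = indicator \<Omega> w *\<^sub>R m w" for w
    define Y where "Y w = indicator \<Omega> w *\<^sub>R f w" for w
    have [measurable]: "X \<in> borel_measurable lebesgue" "Y \<in> borel_measurable lebesgue"
      unfolding X_def Y_def
      by (intro set_borel_measurable_lebesgue_continuous \<Omega>
          holomorphic_several_on_continuous bergman_space_holomorphic[OF m]
          bergman_space_holomorphic[OF f])+
    have [measurable]: "cnj \<in> borel_measurable borel"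
      by (intro borel_measurable_continuous_onI continuous_intros)
    have "(\<lambda>w. indicator \<Omega> w *\<^sub>R (of_real (norm (m w) powr (p - 2)) * cnj (m w) * f w))
        = (\<lambda>w. of_real (norm (X w) powr (p - 2)) * cnj (X w) * Y w)"
      by (auto simp: indicator_def X_def Y_def)
    moreover have "\<dots> \<in> borel_measurable lebesgue" by measurable
    ultimately show "set_borel_measurable lebesgue \<Omega>
        (\<lambda>w. of_real (norm (m w) powr (p - 2)) * cnj (m w) * f w)"
      unfolding set_borel_measurable_def by simp
  qed (use norm_powr_weight_le[OF p] in \<open>auto intro!: AE_I2\<close>)
qed

section \<open>Uniqueness of the minimizer\<close>

text \<open>
  The set where \<open>D\<close> is positive is open and null, and nonempty open sets are not null.
\<close>

lemma zero_on_open_of_set_integral_zero: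
  fixes D :: "'a::euclidean_space \<Rightarrow> real"
  assumes \<Omega>: "open \<Omega>" and D: "continuous_on \<Omega> D" "\<And>w. w \<in> \<Omega> \<Longrightarrow> 0 \<le> D w"
    and int: "set_integrable lebesgue \<Omega> D" and le: "(LINT w:\<Omega>|lebesgue. D w) \<le> 0" and w: "w \<in> \<Omega>"
  shows "D w = 0"
proof -
  have nonneg: "AE w in lebesgue. 0 \<le> indicator \<Omega> w *\<^sub>R D w"
    using D(2) by (intro AE_I2) (simp add: indicator_def)
  then have "integral\<^sup>L lebesgue (\<lambda>w. indicator \<Omega> w *\<^sub>R D w) = 0"
    using le integral_nonneg_AE[OF nonneg] by (simp add: set_lebesgue_integral_def)
  then have "AE w in lebesgue. indicator \<Omega> w *\<^sub>R D w = 0"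
    using integral_nonneg_eq_0_iff_AE[OF int[unfolded set_integrable_def] nonneg] by blast
  then have "negligible {w. indicator \<Omega> w *\<^sub>R D w \<noteq> 0}"
    by (simp add: AE_iff_null_sets negligible_iff_null_sets completion.AE_iff_null_sets AE_iff_null)
  then have "negligible (\<Omega> \<inter> D -` (- {0}))"
    by (rule negligible_subset) auto
  moreover have "open (\<Omega> \<inter> D -` (- {0}))"
    using D(1) \<Omega> by (intro continuous_open_preimage) auto
  ultimately have "\<Omega> \<inter> D -` (- {0}) = {}" using open_not_negligible by blast
  then show ?thesis using w by blast
qed

text \<open>
  A nonempty set of real numbers is not open in the plane, so the open mapping theorem applies.
\<close>

lemma holomorphic_real_valued_constant:
  assumes q: "q holomorphic_on S" and S: "open S" "connected S"
    and real: "\<And>t. t \<in> S \<Longrightarrow> Im (q t) = 0"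
  shows "q constant_on S"
proof (rule ccontr)
  assume nc: "\<not> q constant_on S"
  then obtain s where s: "s \<in> S" by (auto simp: constant_on_def)
  have "open (q ` S)" by (rule open_mapping_thm[OF q S S(1) _ nc]) simp
  then obtain e where e: "0 < e" "ball (q s) e \<subseteq> q ` S" using s by (meson imageI open_contains_ball)
  have "q s + \<i> * of_real (e / 2) \<in> ball (q s) e" using e(1) by (simp add: dist_norm norm_mult)
  then obtain t where "t \<in> S" "q t = q s + \<i> * of_real (e / 2)" using e(2) by (metis imageE subsetD)
  then have "Im (q t) = Im (q s) + e / 2" by simp
  then show False using real[OF \<open>t \<in> S\<close>] real[OF s] e(1) by simp
qed

text \<open>
  The deficit \<open>D\<close> in the convexity inequality for the midpoint \<open>h\<close> is nonnegative and continuous, and its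
  integral is \<open>\<mu>^p - \<parallel>h\<parallel>^p \<le> 0\<close>, where \<open>\<mu>\<close> is the minimal norm.  So \<open>D\<close> vanishes, which is equality in the
  triangle inequality at every point of \<open>\<Omega>\<close>.
\<close>

theorem bergman_minimizer_unique:
  fixes f g :: "complex^'n \<Rightarrow> complex"
  assumes p: "1 \<le> p" and \<Omega>: "open \<Omega>" "connected \<Omega>" and z: "z \<in> \<Omega>"
    and f: "f \<in> bergman_space p \<Omega>" "f z = 1" "bergman_norm p \<Omega> f = min_norm p \<Omega> z"
    and g: "g \<in> bergman_space p \<Omega>" "g z = 1" "bergman_norm p \<Omega> g = min_norm p \<Omega> z"
    and u: "u \<in> \<Omega>"
  shows "f u = g u"
proof -
  define h where "h w = (1/2) * (f w + g w)" for w
  have h: "h \<in> bergman_space p \<Omega>"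
    unfolding h_def by (intro bergman_space_cmult bergman_space_add p \<Omega> f g)
  have hz: "h z = 1" by (simp add: h_def f g)
  define D where "D w = (1/2) * (norm (f w) powr p + norm (g w) powr p) - norm (h w) powr p" for w
  have intD: "set_integrable lebesgue \<Omega> D"
    unfolding D_def using f(1) g(1) h
    by (intro set_integral_diff(1) set_integrable_mult_right set_integral_add(1) bergman_space_integrable) auto
  have "(LINT w:\<Omega>|lebesgue. D w) = (1/2) * ((LINT w:\<Omega>|lebesgue. norm (f w) powr p)
      + (LINT w:\<Omega>|lebesgue. norm (g w) powr p)) - (LINT w:\<Omega>|lebesgue. norm (h w) powr p)"
    unfolding D_def using bergman_space_integrable[OF f(1)] bergman_space_integrable[OF g(1)]
      bergman_space_integrable[OF h]
    by (subst set_integral_diff(2)) (auto simp: set_integral_add(2) intro!: set_integral_add(1))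
  also have "\<dots> = min_norm p \<Omega> z powr p - bergman_norm p \<Omega> h powr p"
    using p f g by (simp flip: bergman_norm_powr)
  also have "\<dots> \<le> 0"
  proof -
    have "min_norm p \<Omega> z \<le> bergman_norm p \<Omega> h" by (rule min_norm_le[OF h hz])
    moreover have "0 \<le> min_norm p \<Omega> z" using f(3) bergman_norm_nonneg by metis
    ultimately show ?thesis using p powr_mono2[of p] by simp
  qed
  finally have leD: "(LINT w:\<Omega>|lebesgue. D w) \<le> 0" .
  have contD: "continuous_on \<Omega> D"
    unfolding D_def using p f(1) g(1) h
    by (intro continuous_intros continuous_on_norm_powr holomorphic_several_on_continuous
        bergman_space_holomorphic) auto
  have D0: "D w = 0" if "w \<in> \<Omega>" for w
  proof (rule zero_on_open_of_set_integral_zero[OF \<Omega>(1) contD _ intD leD that])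
    fix w
    have "norm ((1/2) *\<^sub>R f w + (1/2) *\<^sub>R g w) powr p \<le> 1/2 * norm (f w) powr p + 1/2 * norm (g w) powr p"
      by (rule norm_powr_convex[OF p]) auto
    moreover have "(1/2) *\<^sub>R f w + (1/2) *\<^sub>R g w = h w"
      by (simp add: h_def scaleR_conv_of_real algebra_simps)
    ultimately show "0 \<le> D w" by (simp add: D_def algebra_simps)
  qed
  have aligned: "norm (f w) *\<^sub>R g w = norm (g w) *\<^sub>R f w" if w: "w \<in> \<Omega>" for w
  proof -
    let ?s = "norm (f w) + norm (g w)"
    have "norm ((1/2) *\<^sub>R of_real (norm (f w)) + (1/2) *\<^sub>R of_real (norm (g w)) :: complex) powr p
        \<le> 1/2 * norm (of_real (norm (f w)) :: complex) powr p + 1/2 * norm (of_real (norm (g w)) :: complex) powr p"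
      by (rule norm_powr_convex[OF p]) auto
    moreover have "(1/2) *\<^sub>R of_real (norm (f w)) + (1/2) *\<^sub>R of_real (norm (g w)) = (of_real (?s / 2) :: complex)"
      by (simp add: scaleR_conv_of_real add_divide_distrib)
    moreover have "norm (of_real (?s / 2) :: complex) = ?s / 2"
      unfolding norm_of_real by simp
    \<comment> \<open>Convexity for the moduli; with \<open>D = 0\<close> it bounds \<open>(|f| + |g|) / 2\<close> by \<open>|f + g| / 2\<close>.\<close>
    ultimately have "(?s / 2) powr p \<le> 1/2 * norm (f w) powr p + 1/2 * norm (g w) powr p"
      by (simp only: norm_of_real abs_norm_cancel)
    then have "(?s / 2) powr p \<le> norm (h w) powr p"
      using D0[OF w] by (simp add: D_def)
    then have "?s / 2 \<le> norm (h w)"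
      using p powr_less_mono2[of p "norm (h w)" "?s / 2"] by (meson norm_ge_zero not_le zero_less_one less_le_trans)
    then have "?s \<le> norm (f w + g w)" by (simp add: h_def norm_mult)
    then have "norm (f w + g w) = ?s" using norm_triangle_ineq[of "f w" "g w"] by linarith
    then show ?thesis by (simp add: norm_triangle_eq)
  qed
  have hol: "holomorphic_several_on f \<Omega>" "holomorphic_several_on g \<Omega>"
    using f(1) g(1) by (auto intro: bergman_space_holomorphic)
  have "open (\<Omega> \<inter> f -` (- {0}))"
    by (intro continuous_open_preimage holomorphic_several_on_continuous hol \<Omega>) auto
  moreover have "z \<in> \<Omega> \<inter> f -` (- {0})" using z f(2) by simp
  ultimately obtain r where r: "0 < r" "ball z r \<subseteq> \<Omega> \<inter> f -` (- {0})"
    by (meson open_contains_ball)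
  have eq: "f v - g v = 0" if v: "v \<in> ball z r" for v
  proof -
    let ?L = "\<lambda>t. z + t *s (v - z)"
    let ?S = "{t. ?L t \<in> ball z r}"
    let ?q = "\<lambda>t. g (?L t) / f (?L t)"
    have S: "open ?S" "connected ?S"
      by (intro open_complex_line_preimage open_ball convex_connected convex_complex_line_preimage
          convex_ball)+
    have "?q constant_on ?S"
    proof (rule holomorphic_real_valued_constant[OF _ S])
      show "?q holomorphic_on ?S"
        by (intro holomorphic_on_divide holomorphic_on_complex_line[OF hol(1)]
            holomorphic_on_complex_line[OF hol(2)]) (use r in auto)
      fix t assume "t \<in> ?S"
      then have "?L t \<in> \<Omega>" "f (?L t) \<noteq> 0" using r by auto
      then have "?q t = of_real (norm (g (?L t)) / norm (f (?L t)))"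
        using aligned[of "?L t"] by (simp add: scaleR_conv_of_real field_simps)
      then show "Im (?q t) = 0" by (simp only: Im_complex_of_real)
    qed
    moreover have "0 \<in> ?S" "1 \<in> ?S" using r v by auto
    ultimately have "?q 1 = ?q 0" unfolding constant_on_def by (metis (no_types, lifting))
    then have "g v / f v = 1" using f(2) g(2) by simp
    then show ?thesis by auto
  qed
  have "holomorphic_several_on (\<lambda>w. f w + (-1) * g w) \<Omega>"
    by (intro holomorphic_several_on_add holomorphic_several_on_cmult hol)
  then have "f u + (-1) * g u = 0"
    by (rule holomorphic_several_identity[OF _ \<Omega> r(1) _ _ u]) (use r eq in auto)
  then show ?thesis by simp
qed

section \<open>The reproducing formula\<close>

text \<open>
  The difference quotients of \<open>\<integral> |m + t h|^p\<close> at \<open>t = 1 / Suc n\<close> are nonnegative by minimality; they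
  converge by dominated convergence, with the dominating function \<open>W\<close> coming from convexity.
\<close>

lemma bergman_minimizer_variation:
  fixes m h :: "complex^'n \<Rightarrow> complex"
  assumes p: "1 \<le> p" and \<Omega>: "open \<Omega>"
    and m: "m \<in> bergman_space p \<Omega>" "m z = 1" "bergman_norm p \<Omega> m = min_norm p \<Omega> z"
    and null: "negligible {w \<in> \<Omega>. m w = 0}"
    and h: "h \<in> bergman_space p \<Omega>" "h z = 0"
  shows "0 \<le> (LINT w:\<Omega>|lebesgue. norm (m w) powr (p - 2) * Re (cnj (m w) * h w))"
proof -
  define t where "t n = 1 / real (Suc n)" for n
  have t: "0 < t n" "t n \<le> 1" for n by (auto simp: t_def)
  have t0: "filterlim t (at 0) sequentially"
    unfolding t_def using LIMSEQ_inverse_real_of_nat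
    by (intro filterlim_atI) (auto simp: inverse_eq_divide)
  have pert: "(\<lambda>w. m w + c * h w) \<in> bergman_space p \<Omega>" for c
    by (intro bergman_space_add bergman_space_cmult p \<Omega> m h)
  define Q where "Q n w = (norm (m w + t n *\<^sub>R h w) powr p - norm (m w) powr p) / t n" for n w
  define W where "W w = norm (m w + h w) powr p + norm (m w - h w) powr p + norm (m w) powr p" for w
  define G where "G w = p * (norm (m w) powr (p - 2) * Re (cnj (m w) * h w))" for w
  have i1: "set_integrable lebesgue \<Omega> (\<lambda>w. norm (m w + t n *\<^sub>R h w) powr p)" for n
    using bergman_space_integrable[OF pert[of "of_real (t n)"]] by (simp add: scaleR_conv_of_real)
  have i0: "set_integrable lebesgue \<Omega> (\<lambda>w. norm (m w) powr p)"
    by (rule bergman_space_integrable[OF m(1)])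
  have intQ: "set_integrable lebesgue \<Omega> (Q n)" for n
    unfolding Q_def by (intro set_integrable_divide set_integral_diff(1) i1 i0)
  have Q0: "0 \<le> (LINT w:\<Omega>|lebesgue. Q n w)" for n
  proof -
    have "bergman_norm p \<Omega> m \<le> bergman_norm p \<Omega> (\<lambda>w. m w + of_real (t n) * h w)"
      unfolding m(3) by (rule min_norm_le[OF pert]) (simp add: m h)
    then have "bergman_norm p \<Omega> m powr p \<le> bergman_norm p \<Omega> (\<lambda>w. m w + of_real (t n) * h w) powr p"
      using p bergman_norm_nonneg by (intro powr_mono2) auto
    then have "(LINT w:\<Omega>|lebesgue. norm (m w) powr p) \<le> (LINT w:\<Omega>|lebesgue. norm (m w + t n *\<^sub>R h w) powr p)"
      using p by (simp add: bergman_norm_powr scaleR_conv_of_real)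
    then show ?thesis
      unfolding Q_def using t(1)[of n] i1 i0 by (simp add: set_integral_diff(2))
  qed
  have intW: "set_integrable lebesgue \<Omega> W"
    unfolding W_def
    using bergman_space_integrable[OF pert[of 1]] bergman_space_integrable[OF pert[of "-1"]] i0
    by (intro set_integral_add(1)) auto
  have lim: "(\<lambda>n. Q n w) \<longlonglongrightarrow> G w" if "m w \<noteq> 0" for w
  proof -
    have "((\<lambda>s. (norm (m w + (0 + s) *\<^sub>R h w) powr p - norm (m w + 0 *\<^sub>R h w) powr p) / s) \<longlongrightarrow> G w) (at 0)"
      using DERIV_norm_powr_line[OF that, of "h w" p] unfolding G_def DERIV_def .
    from filterlim_compose[OF this t0] show ?thesis by (simp add: Q_def)
  qed
  have dom: "norm (Q n w) \<le> W w" for n w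
  proof -
    have "Q n w \<le> norm (m w + h w) powr p - norm (m w) powr p"
      "norm (m w) powr p - norm (m w - h w) powr p \<le> Q n w"
      unfolding Q_def by (intro norm_powr_difference_quotient[OF p t])+
    moreover have "0 \<le> norm (m w + h w) powr p" "0 \<le> norm (m w - h w) powr p" "0 \<le> norm (m w) powr p"
      by auto
    ultimately show ?thesis unfolding W_def real_norm_def abs_le_iff by linarith
  qed
  have AEnz: "AE w in lebesgue. w \<in> \<Omega> \<longrightarrow> m w \<noteq> 0"
  proof (rule AE_I')
    show "{w \<in> \<Omega>. m w = 0} \<in> null_sets lebesgue" using null by (simp add: negligible_iff_null_sets)
  qed auto
  have AElim: "AE w in lebesgue. (\<lambda>n. indicator \<Omega> w *\<^sub>R Q n w) \<longlonglongrightarrow> indicator \<Omega> w *\<^sub>R G w"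
    using AEnz by eventually_elim (auto simp: indicator_def lim)
  have measG: "(\<lambda>w. indicator \<Omega> w *\<^sub>R G w) \<in> borel_measurable lebesgue"
  proof -
    have "set_integrable lebesgue \<Omega> (\<lambda>w. of_real (norm (m w) powr (p - 2)) * cnj (m w) * h w)"
      by (rule set_integrable_norm_powr_weight[OF p \<Omega> m(1) h(1)])
    then have "(\<lambda>w. p * Re (indicator \<Omega> w *\<^sub>R (of_real (norm (m w) powr (p - 2)) * cnj (m w) * h w)))
        \<in> borel_measurable lebesgue"
      unfolding set_integrable_def by (intro borel_measurable_times borel_measurable_const
          borel_measurable_integrable integrable_bounded_linear[OF bounded_linear_Re])
    moreover have "(\<lambda>w. p * Re (indicator \<Omega> w *\<^sub>R (of_real (norm (m w) powr (p - 2)) * cnj (m w) * h w)))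
        = (\<lambda>w. indicator \<Omega> w *\<^sub>R G w)"
      by (auto simp: G_def mult.assoc indicator_def Re_complex_of_real)
    ultimately show ?thesis by simp
  qed
  have "(\<lambda>n. integral\<^sup>L lebesgue (\<lambda>w. indicator \<Omega> w *\<^sub>R Q n w)) \<longlonglongrightarrow> integral\<^sup>L lebesgue (\<lambda>w. indicator \<Omega> w *\<^sub>R G w)"
  proof (rule integral_dominated_convergence[where w = "\<lambda>w. indicator \<Omega> w *\<^sub>R W w"])
    show "AE w in lebesgue. norm (indicator \<Omega> w *\<^sub>R Q n w) \<le> indicator \<Omega> w *\<^sub>R W w" for n
      using dom by (intro AE_I2) (auto simp: indicator_def)
  qed (use measG AElim intW intQ in \<open>auto simp: set_integrable_def intro: borel_measurable_integrable\<close>)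
  then have "0 \<le> (LINT w:\<Omega>|lebesgue. G w)"
    unfolding set_lebesgue_integral_def
    by (rule LIMSEQ_le_const) (use Q0 in \<open>auto simp: set_lebesgue_integral_def\<close>)
  then show ?thesis using p by (simp add: G_def zero_le_mult_iff)
qed

text \<open>
  Apply the variational inequality to \<open>c h\<close> with \<open>c = - cnj I\<close>, where \<open>I\<close> is the integral in question:
  it reads \<open>0 \<le> - |I|^2\<close>.
\<close>

theorem bergman_minimizer_orthogonal:
  fixes m h :: "complex^'n \<Rightarrow> complex"
  assumes p: "1 \<le> p" and \<Omega>: "open \<Omega>"
    and m: "m \<in> bergman_space p \<Omega>" "m z = 1" "bergman_norm p \<Omega> m = min_norm p \<Omega> z"
    and null: "negligible {w \<in> \<Omega>. m w = 0}"
    and h: "h \<in> bergman_space p \<Omega>" "h z = 0"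
  shows "(LINT w:\<Omega>|lebesgue. of_real (norm (m w) powr (p - 2)) * cnj (m w) * h w) = 0"
    (is "?I = 0")
proof -
  define c where "c = - cnj ?I"
  have int: "set_integrable lebesgue \<Omega> (\<lambda>w. of_real (norm (m w) powr (p - 2)) * cnj (m w) * (c * h w))"
    by (intro set_integrable_norm_powr_weight p \<Omega> m bergman_space_cmult h)
  have "0 \<le> (LINT w:\<Omega>|lebesgue. norm (m w) powr (p - 2) * Re (cnj (m w) * (c * h w)))"
    using h(2) by (intro bergman_minimizer_variation[OF p \<Omega> m null] bergman_space_cmult h) simp
  also have "\<dots> = (LINT w:\<Omega>|lebesgue. Re (of_real (norm (m w) powr (p - 2)) * cnj (m w) * (c * h w)))"
    by (simp add: mult.assoc Re_complex_of_real)
  also have "\<dots> = Re (LINT w:\<Omega>|lebesgue. of_real (norm (m w) powr (p - 2)) * cnj (m w) * (c * h w))"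
  proof -
    have "(LINT w:\<Omega>|lebesgue. Re (of_real (norm (m w) powr (p - 2)) * cnj (m w) * (c * h w)))
        = (LINT w|lebesgue. Re (indicator \<Omega> w *\<^sub>R (of_real (norm (m w) powr (p - 2)) * cnj (m w) * (c * h w))))"
      by (simp add: set_lebesgue_integral_def)
    also have "\<dots> = Re (LINT w:\<Omega>|lebesgue. of_real (norm (m w) powr (p - 2)) * cnj (m w) * (c * h w))"
      unfolding set_lebesgue_integral_def using int[unfolded set_integrable_def] by (rule integral_Re)
    finally show ?thesis .
  qed
  also have "(LINT w:\<Omega>|lebesgue. of_real (norm (m w) powr (p - 2)) * cnj (m w) * (c * h w)) = c * ?I"
    by (simp add: mult.left_commute[of _ c] set_integral_mult_right)
  also have "Re (c * ?I) = - (norm ?I)\<^sup>2"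
    unfolding c_def cmod_power2 by (simp add: power2_eq_square)
  finally show ?thesis by simp
qed

text \<open>
  Setting a minimizer to 0 off \<open>\<Omega>\<close> changes neither its norm nor its holomorphy, because \<open>\<Omega>\<close> is open.
  With this normalization, uniqueness on \<open>\<Omega>\<close> is uniqueness of the total function, so that the definite
  description in the definition of \<open>minimizer\<close> denotes.
\<close>

lemma minimizer_spec:
  fixes \<Omega> :: "(complex^'n) set"
  assumes \<Omega>: "open \<Omega>" "connected \<Omega>" "bounded \<Omega>" and p: "1 \<le> p" and z: "z \<in> \<Omega>"
  shows "minimizer p \<Omega> z \<in> bergman_space p \<Omega>" "minimizer p \<Omega> z z = 1"
    "bergman_norm p \<Omega> (minimizer p \<Omega> z) = min_norm p \<Omega> z"
proof -
  let ?P = "\<lambda>m. m \<in> bergman_space p \<Omega> \<and> m z = 1 \<and> bergman_norm p \<Omega> m = min_norm p \<Omega> z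
          \<and> (\<forall>w. w \<notin> \<Omega> \<longrightarrow> m w = 0)"
  obtain g where g: "g \<in> bergman_space p \<Omega>" "g z = 1" "bergman_norm p \<Omega> g = min_norm p \<Omega> z"
    by (rule bergman_minimizer_exists[OF \<Omega>(1,3) p z])
  define m where "m w = (if w \<in> \<Omega> then g w else 0)" for w
  have eq: "(\<lambda>w. indicator \<Omega> w *\<^sub>R norm (m w) powr p) = (\<lambda>w. indicator \<Omega> w *\<^sub>R norm (g w) powr p)"
    by (auto simp: m_def indicator_def)
  have "holomorphic_several_on m \<Omega>"
    by (rule holomorphic_several_on_cong[OF bergman_space_holomorphic[OF g(1)] \<Omega>(1)]) (simp add: m_def)
  moreover have "set_integrable lebesgue \<Omega> (\<lambda>w. norm (m w) powr p)"
    using bergman_space_integrable[OF g(1)] unfolding set_integrable_def eq .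
  moreover have "bergman_norm p \<Omega> m = bergman_norm p \<Omega> g"
    unfolding bergman_norm_def set_lebesgue_integral_def eq ..
  ultimately have "?P m" using g z by (auto simp: bergman_space_def m_def)
  moreover have "f = m" if "?P f" for f
  proof
    fix w show "f w = m w"
      using bergman_minimizer_unique[OF p \<Omega>(1,2) z, of f m w] that \<open>?P m\<close> by (cases "w \<in> \<Omega>") auto
  qed
  ultimately have "?P (minimizer p \<Omega> z)"
    unfolding minimizer_def by (rule theI)
  then show "minimizer p \<Omega> z \<in> bergman_space p \<Omega>" "minimizer p \<Omega> z z = 1"
    "bergman_norm p \<Omega> (minimizer p \<Omega> z) = min_norm p \<Omega> z" by auto
qed

lemma min_norm_pos:
  fixes \<Omega> :: "(complex^'n) set"
  assumes p: "1 \<le> p" and \<Omega>: "open \<Omega>" and z: "z \<in> \<Omega>"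
    and m: "m \<in> bergman_space p \<Omega>" "m z = 1" "bergman_norm p \<Omega> m = min_norm p \<Omega> z"
  shows "0 < min_norm p \<Omega> z"
proof (rule ccontr)
  assume "\<not> 0 < min_norm p \<Omega> z"
  then have "bergman_norm p \<Omega> m = 0" using m(3) bergman_norm_nonneg[of p \<Omega> m] by linarith
  then have "(LINT w:\<Omega>|lebesgue. norm (m w) powr p) = 0"
    using p bergman_norm_powr[of p \<Omega> m] by simp
  then have "norm (m z) powr p = 0"
    using p z \<Omega> m(1)
    by (intro zero_on_open_of_set_integral_zero[of \<Omega>] continuous_on_norm_powr bergman_space_integrable
        holomorphic_several_on_continuous bergman_space_holomorphic) auto
  then show False using m(2) by simp
qed

theorem theorem2p13:
  fixes \<Omega> :: "(complex^'n) set" and p :: real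
    and f :: "complex^'n \<Rightarrow> complex" and z :: "complex^'n"
  assumes "open \<Omega>" and "connected \<Omega>" and "\<Omega> \<noteq> {}" and "bounded \<Omega>"
    and "p \<ge> 1"
    and "f \<in> bergman_space p \<Omega>"
    and "z \<in> \<Omega>"
  shows "set_integrable lebesgue \<Omega>
           (\<lambda>w. of_real (norm (minimizer p \<Omega> z w) powr (p - 2)) * cnj (minimizer p \<Omega> z w) * f w)
         \<and> set_integrable lebesgue \<Omega>
           (\<lambda>w. of_real (norm (minimizer p \<Omega> z w) powr (p - 2)) * cnj (bergman_kernel p \<Omega> w z) * f w)
         \<and> f z = of_real (min_norm p \<Omega> z powr (- p)) *
           (LINT w:\<Omega>|lebesgue.
              of_real (norm (minimizer p \<Omega> z w) powr (p - 2)) * cnj (minimizer p \<Omega> z w) * f w)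
         \<and> f z = (LINT w:\<Omega>|lebesgue.
              of_real (norm (minimizer p \<Omega> z w) powr (p - 2)) * cnj (bergman_kernel p \<Omega> w z) * f w)"
proof -
  define m where "m = minimizer p \<Omega> z"
  define \<mu> where "\<mu> = min_norm p \<Omega> z"
  define wt where "wt w = of_real (norm (m w) powr (p - 2)) * cnj (m w)" for w
  note p = \<open>p \<ge> 1\<close>
  have m: "m \<in> bergman_space p \<Omega>" "m z = 1" "bergman_norm p \<Omega> m = min_norm p \<Omega> z"
    unfolding m_def by (rule minimizer_spec; fact)+
  have null: "negligible {w \<in> \<Omega>. m w = 0}"
    by (rule negligible_zeros_holomorphic_several[OF bergman_space_holomorphic[OF m(1)]])
       (use assms m(2) in auto)
  have \<mu>: "0 < \<mu>" unfolding \<mu>_def by (rule min_norm_pos[OF p assms(1,7) m])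
  define h where "h w = f w + (- f z) * m w" for w
  have h: "h \<in> bergman_space p \<Omega>"
    unfolding h_def by (intro bergman_space_add bergman_space_cmult p assms m)
  have hz: "h z = 0" by (simp add: h_def m)
  have int: "set_integrable lebesgue \<Omega> (\<lambda>w. wt w * g w)" if "g \<in> bergman_space p \<Omega>" for g
    unfolding wt_def by (rule set_integrable_norm_powr_weight[OF p assms(1) m(1) that])
  have "(LINT w:\<Omega>|lebesgue. wt w * f w) = (LINT w:\<Omega>|lebesgue. wt w * h w + f z * (wt w * m w))"
    by (simp add: h_def algebra_simps)
  also have "\<dots> = (LINT w:\<Omega>|lebesgue. wt w * h w) + f z * (LINT w:\<Omega>|lebesgue. wt w * m w)"
    using int[OF h] int[OF m(1)] by (subst set_integral_add(2)) (auto intro: set_integrable_mult_right)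
  also have "(LINT w:\<Omega>|lebesgue. wt w * h w) = 0"
    unfolding wt_def by (rule bergman_minimizer_orthogonal[OF p assms(1) m null h hz])
  also have "(LINT w:\<Omega>|lebesgue. wt w * m w) = of_real (\<mu> powr p)"
    unfolding wt_def norm_powr_weight_self set_integral_complex_of_real
    using p m(3) by (simp add: \<mu>_def flip: bergman_norm_powr)
  finally have I: "(LINT w:\<Omega>|lebesgue. wt w * f w) = f z * of_real (\<mu> powr p)" by simp
  have one: "complex_of_real (\<mu> powr - p) * of_real (\<mu> powr p) = 1"
    using \<mu> by (simp flip: of_real_mult powr_add)
  have ker: "of_real (norm (m w) powr (p - 2)) * cnj (bergman_kernel p \<Omega> w z) * f w
      = of_real (\<mu> powr - p) * (wt w * f w)" for w
    by (simp add: bergman_kernel_def bergman_kernel_diag_def m_def \<mu>_def wt_def)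
  have fz: "f z = of_real (\<mu> powr - p) * (LINT w:\<Omega>|lebesgue. wt w * f w)"
    unfolding I using one by (simp add: mult.left_commute)
  show ?thesis
    unfolding m_def[symmetric] \<mu>_def[symmetric] ker unfolding wt_def[symmetric]
    using int[OF assms(6)] fz by (auto intro: set_integrable_mult_right)
qed

end
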